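(* Let $\Omega$ be a slice domain in $\mathbb{H}$, let $I\in\mathbb{S}$, and let $F:\Omega\to M_n(\mathbb{H})$ be a regular matrix-valued function. If for each $k=1,2,\dots,n$ the function $q\mapsto s_k(F(q))$ attains its maximum value on $\Omega_I$ (i.e. its restriction to $\Omega_I$ attains a maximum at some point of $\Omega_I$), then $F$ is constant on $\Omega$.
   Context: $\mathbb{H}$ denotes the real quaternions; $\mathbb{S}=\{q\in\mathbb{H}:q^2=-1\}$; $L_I=\mathbb{R}+\mathbb{R}I$, $\Omega_I=\Omega\cap L_I$. A domain $\Omega$ is a slice domain if it meets the real axis and each $\Omega_I$ is a domain in $L_I$. A function $f:\Omega\to\mathbb{H}$ is (left) regular if for each $I\in\mathbb{S}$, $\frac12(\partial_x+I\partial_y)f(x+yI)=0$ on $\Omega_I$; a matrix-valued function is regular if each entry is. For $A\in M_n(\mathbb{H})$, the singular values $s_1(A)\ge s_2(A)\ge\cdots\ge s_n(A)\ge0$ are the nonnegative square roots of the (real, nonnegative) eigenvalues of $A^*A$, counted with multiplicity; equivalently, the singular values of the complex adjoint matrix $\begin{bmatrix}A_1&A_2\\-\overline{A_2}&\overline{A_1}\end{bmatrix}$ (where $A=A_1+A_2j$ with $A_1,A_2\in M_n(\mathbb{C})$) are the $s_k(A)$, each repeated twice. *)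

theory Defs
  imports "HOL-Analysis.Analysis" "Jordan_Normal_Form.Char_Poly"
begin

text \<open>Quaternions q = a + b j are represented as pairs (a, b) of complex numbers
  (complex i plays the role of the quaternion i). The product topology / norm on
  complex \<times> complex coincides with the Euclidean one on H = R^4.\<close>

type_synonym quat = "complex \<times> complex"

definition qmult :: "quat \<Rightarrow> quat \<Rightarrow> quat" where
  "qmult p q = (fst p * fst q - snd p * cnj (snd q), fst p * snd q + snd p * cnj (fst q))"

definition qreal :: "real \<Rightarrow> quat" where
  "qreal x = (complex_of_real x, 0)"

definition qsphere :: "quat set" where
  "qsphere = {q. qmult q q = qreal (-1)}"

definition slice :: "quat \<Rightarrow> quat set" where
  "slice I = {qreal x + y *\<^sub>R I | x y. True}"

definition slice_domain :: "quat set \<Rightarrow> bool" where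
  "slice_domain \<Omega> \<longleftrightarrow> open \<Omega> \<and> connected \<Omega> \<and> \<Omega> \<inter> range qreal \<noteq> {} \<and>
     (\<forall>I\<in>qsphere. openin (top_of_set (slice I)) (\<Omega> \<inter> slice I) \<and> connected (\<Omega> \<inter> slice I)
        \<and> \<Omega> \<inter> slice I \<noteq> {})"

definition regular :: "quat set \<Rightarrow> (quat \<Rightarrow> quat) \<Rightarrow> bool" where
  "regular \<Omega> f \<longleftrightarrow> (\<forall>I\<in>qsphere.
     (\<lambda>(x::real, y::real). f (qreal x + y *\<^sub>R I)) differentiable_on
        {(x, y). qreal x + y *\<^sub>R I \<in> \<Omega>} \<and>
     (\<forall>x y. qreal x + y *\<^sub>R I \<in> \<Omega> \<longrightarrow>
        (\<exists>Dx Dy. ((\<lambda>t. f (qreal t + y *\<^sub>R I)) has_vector_derivative Dx) (at x) \<and>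
                 ((\<lambda>t. f (qreal x + t *\<^sub>R I)) has_vector_derivative Dy) (at y) \<and>
                 (1/2::real) *\<^sub>R (Dx + qmult I Dy) = 0)))"

text \<open>Complex adjoint of an n\<times>n quaternion matrix A = A1 + A2 j (entries A i j, i,j < n):
  [[A1, A2], [-conj A2, conj A1]].\<close>
definition cadj :: "nat \<Rightarrow> (nat \<Rightarrow> nat \<Rightarrow> quat) \<Rightarrow> complex mat" where
  "cadj n A = mat (2*n) (2*n) (\<lambda>(i, j).
     if i < n \<and> j < n then fst (A i j)
     else if i < n then snd (A i (j - n))
     else if j < n then - cnj (snd (A (i - n) j))
     else cnj (fst (A (i - n) (j - n))))"

definition cmat_adj :: "complex mat \<Rightarrow> complex mat" where
  "cmat_adj M = mat (dim_col M) (dim_row M) (\<lambda>(i, j). cnj (M $$ (j, i)))"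

text \<open>Eigenvalues (with multiplicity) of chi(A)^* chi(A), sorted decreasingly. These are the
  squares of the singular values of chi(A), i.e. s_1(A)^2, s_1(A)^2, s_2(A)^2, s_2(A)^2, ...\<close>
definition cadj_gram_eigs :: "nat \<Rightarrow> (nat \<Rightarrow> nat \<Rightarrow> quat) \<Rightarrow> real list" where
  "cadj_gram_eigs n A = rev (sorted_list_of_multiset
      (image_mset Re (proots (char_poly (cmat_adj (cadj n A) * cadj n A)))))"

definition sval :: "nat \<Rightarrow> (nat \<Rightarrow> nat \<Rightarrow> quat) \<Rightarrow> nat \<Rightarrow> real" where
  "sval n A k = sqrt (cadj_gram_eigs n A ! (2 * (k - 1)))"

end

theory Submission
  imports "HOL-Complex_Analysis.Complex_Analysis" Defs
begin

text \<open>By Ky Fan's principle, \<open>s\<^sub>1\<^sup>2 + \<dots> + s\<^sub>k\<^sup>2\<close> is the maximum of \<open>\<Sum>\<bar>F(q) v\<bar>\<^sup>2\<close> over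
  orthonormal frames \<open>v\<close> of size \<open>k\<close>. Up to left multiplication by a constant, each \<open>F(q) v\<close> is a pair
  of holomorphic functions on the slice, so the strong maximum principle applies to such a sum: if
  \<open>s\<^sub>1, \<dots>, s\<^sub>k\<^sub>-\<^sub>1\<close> are already known to be constant and \<open>s\<^sub>k\<close> attains its maximum at \<open>q0\<close>, then
  an optimal frame for \<open>q0\<close> gives \<open>F(q) v = F(q0) v\<close> on the whole slice, and \<open>s\<^sub>k\<close> is constant.
  For \<open>k = n\<close> the frame is a basis, so \<open>F\<close> is constant on the slice; the identity theorem carries
  this over to all slices through the real axis. Quaternionic vectors are handled as vectors in
  \<open>\<complex>\<^sup>2\<^sup>n\<close> with an antilinear map \<open>J\<close>; eigenvectors \<open>x\<close> and \<open>J x\<close> come in pairs, which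
  doubles each singular value.\<close>

section \<open>Linear algebra on complex coordinate vectors\<close>

text \<open>Vectors of C^N are functions on all naturals of which only the coordinates below
  \<open>N\<close> count. Hence vector equalities and eigenvector equations are stated below
  \<open>N\<close> only, and \<open>cip_cong\<close> transfers them to inner products.\<close>

definition cip :: "nat \<Rightarrow> (nat \<Rightarrow> complex) \<Rightarrow> (nat \<Rightarrow> complex) \<Rightarrow> complex" where
  "cip N x y = (\<Sum>i<N. x i * cnj (y i))"

definition app :: "nat \<Rightarrow> (nat \<Rightarrow> nat \<Rightarrow> complex) \<Rightarrow> (nat \<Rightarrow> complex) \<Rightarrow> nat \<Rightarrow> complex" where
  "app N A x = (\<lambda>i. \<Sum>j<N. A i j * x j)"

definition gram :: "nat \<Rightarrow> (nat \<Rightarrow> nat \<Rightarrow> complex) \<Rightarrow> nat \<Rightarrow> nat \<Rightarrow> complex" where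
  "gram N M i j = (\<Sum>k<N. cnj (M k i) * M k j)"

definition orthoframe :: "nat \<Rightarrow> nat \<Rightarrow> (nat \<Rightarrow> nat \<Rightarrow> complex) \<Rightarrow> bool" where
  "orthoframe N k Y \<longleftrightarrow> (\<forall>a<k. \<forall>b<k. cip N (Y a) (Y b) = (if a = b then 1 else 0))"

lemma cip_cong: "(\<And>i. i < N \<Longrightarrow> x i = x' i) \<Longrightarrow> (\<And>i. i < N \<Longrightarrow> y i = y' i) \<Longrightarrow> cip N x y = cip N x' y'"
  by (simp add: cip_def)

lemma cip_commute: "cip N y x = cnj (cip N x y)"
  by (simp add: cip_def mult.commute)

lemma cip_mult_commute: "cip N y x * cip N x y = of_real ((cmod (cip N y x))\<^sup>2)"
  unfolding cip_commute[of N y x] complex_norm_square by simp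

lemma cip_diff_left: "cip N (\<lambda>i. x i - y i) z = cip N x z - cip N y z"
  by (simp add: cip_def algebra_simps sum_subtractf)

lemma cip_scale_left: "cip N (\<lambda>i. c * x i) z = c * cip N x z"
  by (simp add: cip_def algebra_simps sum_distrib_left)

lemma cip_scale_right: "cip N x (\<lambda>i. c * z i) = cnj c * cip N x z"
  by (simp add: cip_def algebra_simps sum_distrib_left)

lemma cip_sum_left: "cip N (\<lambda>i. \<Sum>b\<in>B. c b * Y b i) z = (\<Sum>b\<in>B. c b * cip N (Y b) z)"
proof -
  have "cip N (\<lambda>i. \<Sum>b\<in>B. c b * Y b i) z = (\<Sum>i<N. \<Sum>b\<in>B. c b * Y b i * cnj (z i))"
    by (simp add: cip_def sum_distrib_right)
  also have "\<dots> = (\<Sum>b\<in>B. \<Sum>i<N. c b * Y b i * cnj (z i))" by (rule sum.swap)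
  finally show ?thesis by (simp add: cip_def sum_distrib_left mult.assoc)
qed

lemma cip_self: "cip N x x = of_real (\<Sum>i<N. (cmod (x i))\<^sup>2)"
  unfolding cip_def of_real_sum complex_norm_square ..

lemma cip_self_eq_0_iff: "cip N x x = 0 \<longleftrightarrow> (\<forall>i<N. x i = 0)"
proof -
  have "(\<Sum>i<N. (cmod (x i))\<^sup>2) = 0 \<longleftrightarrow> (\<forall>i<N. x i = 0)"
    by (subst sum_nonneg_eq_0_iff) auto
  then show ?thesis unfolding cip_self of_real_eq_0_iff .
qed

text \<open>Turns the quadratic form of M^* M, whose spectrum defines the singular values, into the
  square norms |M x|^2 to which the maximum principle is applied.\<close>

lemma cip_gram: "cip N (app N (gram N M) x) y = cip N (app N M x) (app N M y)"
proof -
  have "cip N (app N (gram N M) x) y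
      = (\<Sum>i<N. \<Sum>j<N. \<Sum>k<N. cnj (M k i) * M k j * x j * cnj (y i))"
    by (simp add: cip_def app_def gram_def sum_distrib_right)
  also have "\<dots> = (\<Sum>i<N. \<Sum>k<N. \<Sum>j<N. cnj (M k i) * M k j * x j * cnj (y i))"
    by (intro sum.cong refl sum.swap)
  also have "\<dots> = (\<Sum>k<N. \<Sum>i<N. \<Sum>j<N. cnj (M k i) * M k j * x j * cnj (y i))"
    by (rule sum.swap)
  also have "\<dots> = (\<Sum>k<N. \<Sum>j<N. \<Sum>i<N. cnj (M k i) * M k j * x j * cnj (y i))"
    by (intro sum.cong refl sum.swap)
  also have "\<dots> = cip N (app N M x) (app N M y)"
    by (simp add: cip_def app_def sum_product mult_ac)
  finally show ?thesis .
qed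

lemma cip_gram_right: "cip N x (app N (gram N M) y) = cip N (app N (gram N M) x) y"
  unfolding cip_commute[of N x "app N (gram N M) y"] cip_gram by (simp flip: cip_commute)

section \<open>Existence of eigenvectors\<close>

lemma app_diff_scale:
  "app N A (\<lambda>i. x i - r * y i) = (\<lambda>i. app N A x i - r * app N A y i)"
  by (simp add: app_def fun_eq_iff algebra_simps sum_subtractf sum_distrib_left)

lemma homogeneous_solution:
  fixes A :: "nat \<Rightarrow> nat \<Rightarrow> complex"
  assumes "m < N"
  obtains c where "\<exists>k<N. c k \<noteq> 0" "\<And>i. i < m \<Longrightarrow> (\<Sum>k<N. A i k * c k) = 0"
proof -
  \<comment> \<open>Zero rows pad the \<open>m\<close> equations to a square system. As
    \<open>m < N\<close>, row \<open>m\<close> is one of them, so the determinant vanishes.\<close>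
  define B where "B = Matrix.mat N N (\<lambda>(i, k). if i < m then A i k else 0)"
  have B: "B \<in> carrier_mat N N" by (simp add: B_def)
  have "B = mat\<^sub>r N N (\<lambda>i. if i = m then 0\<^sub>v N else Matrix.row B i)"
    using assms by (intro eq_matI) (auto simp: B_def)
  moreover have "Determinant.det (mat\<^sub>r N N (\<lambda>i. if i = m then 0\<^sub>v N else Matrix.row B i)) = 0"
    using assms B by (intro det_row_0) auto
  ultimately have "Determinant.det B = 0" by simp
  then obtain v where v: "v \<in> carrier_vec N" "v \<noteq> 0\<^sub>v N" "B *\<^sub>v v = 0\<^sub>v N"
    using det_0_iff_vec_prod_zero[OF B] by blast
  show ?thesis
  proof (rule that)
    show "\<exists>k<N. vec_index v k \<noteq> 0"
      using v(1,2) by (metis carrier_vecD eq_vecI index_zero_vec(1,2))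
    fix i assume i: "i < m"
    have "vec_index (B *\<^sub>v v) i = (\<Sum>k<N. A i k * vec_index v k)"
      using i assms v(1) by (auto simp: B_def scalar_prod_def atLeast0LessThan intro!: sum.cong)
    then show "(\<Sum>k<N. A i k * vec_index v k) = 0"
      using v(3) i assms by simp
  qed
qed

text \<open>The coordinate form of p(H) y = q(H) (H y - r y) for p = (X - r) q, where
  \<open>v k\<close> will be a coordinate of H^k y.\<close>

lemma sum_coeff_linear_factor:
  fixes q :: "complex poly"
  assumes "q \<noteq> 0"
  shows "(\<Sum>k\<le>degree ([:-r, 1:] * q). coeff ([:-r, 1:] * q) k * v k)
       = (\<Sum>k\<le>degree q. coeff q k * (v (Suc k) - r * v k))"
proof -
  have deg: "degree ([:-r, 1:] * q) = Suc (degree q)"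
    using assms by (subst degree_mult_eq) auto
  have p: "[:-r, 1:] * q = pCons 0 q - Polynomial.smult r q" by simp
  have "(\<Sum>k\<le>Suc (degree q). coeff ([:-r, 1:] * q) k * v k)
      = (\<Sum>k\<le>Suc (degree q). coeff (pCons 0 q) k * v k) - (\<Sum>k\<le>Suc (degree q). r * coeff q k * v k)"
    unfolding p by (simp only: coeff_diff coeff_smult left_diff_distrib sum_subtractf)
  also have "(\<Sum>k\<le>Suc (degree q). coeff (pCons 0 q) k * v k) = (\<Sum>k\<le>degree q. coeff q k * v (Suc k))"
    by (subst sum.atMost_Suc_shift) simp
  also have "(\<Sum>k\<le>Suc (degree q). r * coeff q k * v k) = (\<Sum>k\<le>degree q. r * coeff q k * v k)"
    by (simp add: coeff_eq_0)
  finally show ?thesis unfolding deg by (simp add: algebra_simps sum_subtractf)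
qed

text \<open>If a nonzero polynomial in \<open>H\<close> kills \<open>y\<close>, split off linear factors until
  one of them kills a nonzero vector.\<close>

lemma eigenvector_of_annihilator:
  assumes inv: "\<And>x r. W x \<Longrightarrow> W (\<lambda>i. app N H x i - r * x i)"
    and "p \<noteq> 0" "W y" "\<exists>i<N. y i \<noteq> 0"
    and "\<forall>i<N. (\<Sum>k\<le>degree p. coeff p k * (app N H ^^ k) y i) = 0"
  shows "\<exists>z r. W z \<and> (\<exists>i<N. z i \<noteq> 0) \<and> (\<forall>i<N. app N H z i = r * z i)"
  using assms(2-)
proof (induction "degree p" arbitrary: p y)
  case 0
  then obtain c where "p = [:c:]" by (metis degree_eq_zeroE)
  with 0 show ?case by auto
next
  case (Suc d)
  then have "\<not> constant (poly p)" by (simp add: constant_degree)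
  then obtain r where "poly p r = 0" using fundamental_theorem_of_algebra by blast
  then obtain q where p: "p = [:-r, 1:] * q" by (auto simp: poly_eq_0_iff_dvd dvd_def)
  with Suc have q0: "q \<noteq> 0" by auto
  have "degree p = Suc (degree q)" unfolding p using q0 by (subst degree_mult_eq) auto
  with Suc have dq: "d = degree q" by simp
  define z where "z = (\<lambda>i. app N H y i - r * y i)"
  \<comment> \<open>Powers of H commute with H - r.\<close>
  have pow: "(app N H ^^ k) z = (\<lambda>i. (app N H ^^ Suc k) y i - r * (app N H ^^ k) y i)" for k
    by (induction k) (simp_all add: z_def app_diff_scale)
  have zero: "\<forall>i<N. (\<Sum>k\<le>degree q. coeff q k * (app N H ^^ k) z i) = 0"
    using Suc.prems(4) sum_coeff_linear_factor[OF q0, of r] unfolding p pow by simp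
  show ?case
  proof (cases "\<exists>i<N. z i \<noteq> 0")
    case True
    show ?thesis
      by (rule Suc.hyps(1)[OF dq q0 _ True zero]) (simp add: z_def inv Suc.prems)
  next
    case False
    then have "\<forall>i<N. app N H y i = r * y i" by (simp add: z_def)
    with Suc.prems show ?thesis by blast
  qed
qed

text \<open>The \<open>N + 1\<close> vectors y, H y, ..., H^N y are linearly dependent, which yields
  a nonzero polynomial annihilating \<open>y\<close>. Only factors H - r are ever applied, so
  closure of \<open>W\<close> under these keeps the eigenvector in \<open>W\<close>.\<close>

lemma eigenvector_in_invariant_subspace:
  assumes inv: "\<And>x r. W x \<Longrightarrow> W (\<lambda>i. app N H x i - r * x i)"
    and y: "W y" "\<exists>i<N. y i \<noteq> 0"
  obtains z r where "W z" "\<exists>i<N. z i \<noteq> 0" "\<forall>i<N. app N H z i = r * z i"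
proof -
  obtain c where c: "\<exists>k<Suc N. c k \<noteq> 0"
      "\<And>i. i < N \<Longrightarrow> (\<Sum>k<Suc N. (app N H ^^ k) y i * c k) = 0"
    by (rule homogeneous_solution[of N "Suc N" "\<lambda>i k. (app N H ^^ k) y i"]) auto
  define p where "p = (\<Sum>k<Suc N. Polynomial.monom (c k) k)"
  have cp: "coeff p k = (if k < Suc N then c k else 0)" for k
    by (simp add: p_def coeff_sum sum.delta)
  have p0: "p \<noteq> 0" using c(1) cp by (metis coeff_0)
  have "degree p < Suc N" using cp p0 by (metis leading_coeff_0_iff)
  have "(\<Sum>k\<le>degree p. coeff p k * (app N H ^^ k) y i) = 0" if "i < N" for i
  proof -
    have "(\<Sum>k\<le>degree p. coeff p k * (app N H ^^ k) y i) = (\<Sum>k<Suc N. coeff p k * (app N H ^^ k) y i)"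
      using \<open>degree p < Suc N\<close> by (intro sum.mono_neutral_left) (auto simp: coeff_eq_0)
    also have "\<dots> = (\<Sum>k<Suc N. (app N H ^^ k) y i * c k)"
      by (intro sum.cong) (auto simp: cp)
    finally show ?thesis using c(2)[OF that] by simp
  qed
  with eigenvector_of_annihilator[OF inv p0 y] that show ?thesis by blast
qed

section \<open>Orthonormal bases\<close>

lemma orthoframe_complete:
  assumes "orthoframe N N X" "i < N" "j < N"
  shows "(\<Sum>a<N. X a i * cnj (X a j)) = (if i = j then 1 else 0)"
proof -
  define U where "U = Matrix.mat N N (\<lambda>(i, a). X a i)"
  define V where "V = Matrix.mat N N (\<lambda>(a, i). cnj (X a i))"
  have "V * U = 1\<^sub>m N"
  proof (rule eq_matI)
    fix a b assume "a < dim_row (1\<^sub>m N :: complex mat)" "b < dim_col (1\<^sub>m N :: complex mat)"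
    then have ab: "a < N" "b < N" by auto
    have "(V * U) $$ (a, b) = cip N (X b) (X a)"
      using ab by (auto simp: U_def V_def scalar_prod_def cip_def atLeast0LessThan mult.commute intro!: sum.cong)
    then show "(V * U) $$ (a, b) = 1\<^sub>m N $$ (a, b)"
      using assms(1) ab by (auto simp: orthoframe_def)
  qed (auto simp: U_def V_def)
  \<comment> \<open>For square matrices a left inverse is a right inverse: orthonormal columns give
    orthonormal rows.\<close>
  then have "U * V = 1\<^sub>m N"
    by (rule mat_mult_left_right_inverse[rotated 2]) (auto simp: U_def V_def)
  moreover have "(U * V) $$ (i, j) = (\<Sum>a<N. X a i * cnj (X a j))"
    using assms(2,3) by (auto simp: U_def V_def scalar_prod_def atLeast0LessThan intro!: sum.cong)
  ultimately show ?thesis using assms(2,3) by simp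
qed

lemma orthoframe_expansion:
  assumes X: "orthoframe N N X" and "i < N"
  shows "y i = (\<Sum>a<N. cip N y (X a) * X a i)"
proof -
  have "(\<Sum>a<N. cip N y (X a) * X a i) = (\<Sum>a<N. \<Sum>j<N. y j * (X a i * cnj (X a j)))"
    by (simp add: cip_def sum_distrib_left sum_distrib_right mult_ac)
  also have "\<dots> = (\<Sum>j<N. \<Sum>a<N. y j * (X a i * cnj (X a j)))" by (rule sum.swap)
  also have "\<dots> = (\<Sum>j<N. if j = i then y j else 0)"
    unfolding sum_distrib_left[symmetric]
    by (intro sum.cong refl) (use orthoframe_complete[OF X \<open>i < N\<close>] in auto)
  also have "\<dots> = y i" using \<open>i < N\<close> by simp
  finally show ?thesis by simp
qed

lemma app_orthoframe_expansion:
  assumes X: "orthoframe N N X"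
  shows "app N A y i = (\<Sum>a<N. cip N y (X a) * app N A (X a) i)"
proof -
  have "app N A y i = (\<Sum>j<N. A i j * (\<Sum>a<N. cip N y (X a) * X a j))"
    unfolding app_def by (intro sum.cong refl arg_cong2[of _ _ _ _ "(*)"] orthoframe_expansion[OF X]) auto
  also have "\<dots> = (\<Sum>j<N. \<Sum>a<N. cip N y (X a) * (A i j * X a j))"
    by (simp add: sum_distrib_left mult_ac)
  also have "\<dots> = (\<Sum>a<N. \<Sum>j<N. cip N y (X a) * (A i j * X a j))" by (rule sum.swap)
  finally show ?thesis by (simp add: app_def sum_distrib_left)
qed

lemma parseval:
  assumes "orthoframe N N X"
  shows "(\<Sum>a<N. (cmod (cip N y (X a)))\<^sup>2) = Re (cip N y y)"
proof -
  have "cip N y y = cip N (\<lambda>i. \<Sum>a<N. cip N y (X a) * X a i) y"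
    by (rule cip_cong) (use orthoframe_expansion[OF assms] in auto)
  also have "\<dots> = (\<Sum>a<N. cip N y (X a) * cip N (X a) y)" by (rule cip_sum_left)
  also have "\<dots> = (\<Sum>a<N. of_real ((cmod (cip N y (X a)))\<^sup>2))"
    by (simp only: cip_mult_commute)
  finally show ?thesis by simp
qed

lemma quadratic_form_eigenbasis:
  assumes "orthoframe N N X"
    and ev: "\<And>a i. a < N \<Longrightarrow> i < N \<Longrightarrow> app N A (X a) i = of_real (D a) * X a i"
  shows "Re (cip N (app N A y) y) = (\<Sum>a<N. D a * (cmod (cip N y (X a)))\<^sup>2)"
proof -
  have "cip N (app N A y) y = cip N (\<lambda>i. \<Sum>a<N. (cip N y (X a) * of_real (D a)) * X a i) y"
    by (rule cip_cong) (auto simp: app_orthoframe_expansion[OF assms(1), of A y] ev mult.assoc intro!: sum.cong)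
  also have "\<dots> = (\<Sum>a<N. cip N y (X a) * of_real (D a) * cip N (X a) y)" by (rule cip_sum_left)
  also have "\<dots> = (\<Sum>a<N. of_real (D a * (cmod (cip N y (X a)))\<^sup>2))"
  proof (intro sum.cong refl)
    fix a
    show "cip N y (X a) * of_real (D a) * cip N (X a) y = of_real (D a * (cmod (cip N y (X a)))\<^sup>2)"
      unfolding of_real_mult cip_mult_commute[symmetric] by (simp add: mult_ac)
  qed
  finally show ?thesis by simp
qed

text \<open>Here \<open>s\<close> is the projection of \<open>x\<close> onto the span of the frame.
  The remainder \<open>z\<close> is orthogonal to it, so |z|^2 is the difference of the two
  sides.\<close>

lemma bessel:
  assumes "orthoframe N k Y"
  shows "(\<Sum>b<k. (cmod (cip N x (Y b)))\<^sup>2) \<le> Re (cip N x x)"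
proof -
  define s where "s = (\<lambda>i. \<Sum>b<k. cip N x (Y b) * Y b i)"
  define z where "z = (\<lambda>i. x i - s i)"
  have "cip N z (Y b) = 0" if "b < k" for b
  proof -
    have "cip N s (Y b) = (\<Sum>a<k. cip N x (Y a) * cip N (Y a) (Y b))"
      unfolding s_def by (rule cip_sum_left)
    also have "\<dots> = (\<Sum>a<k. if a = b then cip N x (Y a) else 0)"
      using assms that by (intro sum.cong) (auto simp: orthoframe_def)
    also have "\<dots> = cip N x (Y b)" using that by simp
    finally show ?thesis by (simp add: z_def cip_diff_left)
  qed
  then have "cip N s z = 0"
    unfolding s_def cip_sum_left by (intro sum.neutral) (simp add: cip_commute[of N _ z])
  then have "cip N z z = cip N x z" by (simp add: z_def cip_diff_left)
  also have "\<dots> = cnj (cip N x x - cip N s x)"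
    unfolding cip_commute[of N x z] by (simp add: z_def cip_diff_left)
  also have "cip N s x = (\<Sum>b<k. of_real ((cmod (cip N x (Y b)))\<^sup>2))"
    unfolding s_def cip_sum_left by (simp only: cip_mult_commute)
  finally have "Re (cip N z z) = Re (cip N x x) - (\<Sum>b<k. (cmod (cip N x (Y b)))\<^sup>2)" by simp
  moreover have "Re (cip N z z) \<ge> 0" by (simp add: cip_self sum_nonneg)
  ultimately show ?thesis by simp
qed

section \<open>Ky Fan's maximum principle\<close>

lemma weighted_sum_le_top_sum:
  fixes D w :: "nat \<Rightarrow> real"
  assumes "K \<le> N" and anti: "\<And>a b. a \<le> b \<Longrightarrow> b < N \<Longrightarrow> D b \<le> D a"
    and w: "\<And>a. a < N \<Longrightarrow> 0 \<le> w a" "\<And>a. a < N \<Longrightarrow> w a \<le> 1" "(\<Sum>a<N. w a) = real K"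
  shows "(\<Sum>a<N. D a * w a) \<le> (\<Sum>a<K. D a)"
proof -
  \<comment> \<open>The last of the \<open>K\<close> top values is the threshold: after subtracting
    it, terms of index below \<open>K\<close> are nonnegative with weight at most 1, and all others
    are nonpositive. For \<open>K = 0\<close> truncated subtraction makes \<open>t = D 0\<close>,
    and the bounds still hold.\<close>
  define t where "t = D (K - 1)"
  have sub: "{..<K} \<subseteq> {..<N}" using assms(1) by auto
  have "(\<Sum>a<N. (D a - t) * w a) \<le> (\<Sum>a<N. if a < K then D a - t else 0)"
  proof (rule sum_mono)
    fix a assume "a \<in> {..<N}"
    then have a: "a < N" by simp
    show "(D a - t) * w a \<le> (if a < K then D a - t else 0)"
    proof (cases "a < K")
      case True
      then have "0 \<le> D a - t" using anti[of a "K - 1"] assms(1) by (auto simp: t_def)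
      then show ?thesis using True w(1,2)[OF a] by (simp add: mult_left_le)
    next
      case False
      then have "D a - t \<le> 0" using anti[of "K - 1" a] a by (auto simp: t_def)
      then show ?thesis using False w(1)[OF a] by (simp add: mult_nonpos_nonneg)
    qed
  qed
  also have "\<dots> = (\<Sum>a<K. D a - t)"
    using sub by (simp add: sum.If_cases Int_absorb1 lessThan_def[symmetric])
  also have "\<dots> = (\<Sum>a<K. D a) - real K * t" by (simp add: sum_subtractf)
  finally have "(\<Sum>a<N. D a * w a) - t * (\<Sum>a<N. w a) \<le> (\<Sum>a<K. D a) - real K * t"
    by (simp add: algebra_simps sum_subtractf sum_distrib_left)
  then show ?thesis using w(3) by simp
qed

text \<open>In the eigenbasis the left side is a weighted sum of the \<open>D a\<close>. Bessel for
  \<open>Y\<close> bounds each weight by 1 and Parseval for \<open>X\<close> gives them total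
  \<open>k\<close>, so the sum is largest with weight 1 on the top \<open>k\<close> values.\<close>

lemma ky_fan:
  assumes X: "orthoframe N N X"
    and ev: "\<And>a i. a < N \<Longrightarrow> i < N \<Longrightarrow> app N A (X a) i = of_real (D a) * X a i"
    and anti: "\<And>a b. a \<le> b \<Longrightarrow> b < N \<Longrightarrow> D b \<le> D a"
    and Y: "orthoframe N k Y" and "k \<le> N"
  shows "(\<Sum>b<k. Re (cip N (app N A (Y b)) (Y b))) \<le> (\<Sum>a<k. D a)"
proof -
  define w where "w = (\<lambda>a. \<Sum>b<k. (cmod (cip N (Y b) (X a)))\<^sup>2)"
  have "(\<Sum>b<k. Re (cip N (app N A (Y b)) (Y b))) = (\<Sum>b<k. \<Sum>a<N. D a * (cmod (cip N (Y b) (X a)))\<^sup>2)"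
    using quadratic_form_eigenbasis[OF X ev] by simp
  also have "\<dots> = (\<Sum>a<N. D a * w a)"
    by (subst sum.swap) (simp add: w_def sum_distrib_left)
  also have "\<dots> \<le> (\<Sum>a<k. D a)"
  proof (rule weighted_sum_le_top_sum[OF \<open>k \<le> N\<close> anti])
    fix a assume "a < N"
    show "0 \<le> w a" by (simp add: w_def sum_nonneg)
    have "w a = (\<Sum>b<k. (cmod (cip N (X a) (Y b)))\<^sup>2)"
      unfolding w_def by (intro sum.cong refl) (simp add: cip_commute[of N "X a"])
    then show "w a \<le> 1" using bessel[OF Y, of "X a"] X \<open>a < N\<close> by (simp add: orthoframe_def)
  next
    have "(\<Sum>a<N. w a) = (\<Sum>b<k. \<Sum>a<N. (cmod (cip N (Y b) (X a)))\<^sup>2)"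
      unfolding w_def by (rule sum.swap)
    also have "\<dots> = (\<Sum>b<k. 1)"
      using Y by (intro sum.cong refl) (auto simp: parseval[OF X] orthoframe_def)
    finally show "(\<Sum>a<N. w a) = real k" by simp
  qed
  finally show ?thesis .
qed

text \<open>The link from eigenbases to the roots of a characteristic polynomial, by which
  \<open>sval\<close> is defined. With the basis as columns of \<open>U\<close>, the matrix
  \<open>B\<close> is U E U^* with \<open>E\<close> diagonal.\<close>

lemma char_poly_eigenbasis:
  assumes X: "orthoframe N N X"
    and ev: "\<And>a i. a < N \<Longrightarrow> i < N \<Longrightarrow> app N A (X a) i = of_real (D a) * X a i"
    and B: "B \<in> carrier_mat N N" "\<And>i j. i < N \<Longrightarrow> j < N \<Longrightarrow> B $$ (i, j) = A i j"
  shows "char_poly B = (\<Prod>a\<leftarrow>map (\<lambda>a. complex_of_real (D a)) [0..<N]. [:- a, 1:])"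
proof -
  define U where "U = Matrix.mat N N (\<lambda>(i, a). X a i)"
  define V where "V = Matrix.mat N N (\<lambda>(a, i). cnj (X a i))"
  define E where "E = Matrix.mat N N (\<lambda>(a, b). if a = b then complex_of_real (D a) else 0)"
  have UV: "U * V = 1\<^sub>m N"
  proof (rule eq_matI)
    fix i j assume "i < dim_row (1\<^sub>m N :: complex mat)" "j < dim_col (1\<^sub>m N :: complex mat)"
    then have ij: "i < N" "j < N" by auto
    have "(U * V) $$ (i, j) = (\<Sum>a<N. X a i * cnj (X a j))"
      using ij by (auto simp: U_def V_def scalar_prod_def atLeast0LessThan intro!: sum.cong)
    then show "(U * V) $$ (i, j) = 1\<^sub>m N $$ (i, j)"
      using ij orthoframe_complete[OF X] by simp
  qed (auto simp: U_def V_def)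
  have VU: "V * U = 1\<^sub>m N"
    by (rule mat_mult_left_right_inverse[OF _ _ UV]) (auto simp: U_def V_def)
  have BU: "B * U = U * E"
  proof (rule eq_matI)
    fix i a assume "i < dim_row (U * E)" "a < dim_col (U * E)"
    then have ia: "i < N" "a < N" by (auto simp: U_def E_def)
    have "(B * U) $$ (i, a) = app N A (X a) i"
      using ia B by (auto simp: U_def scalar_prod_def atLeast0LessThan app_def intro!: sum.cong)
    also have "\<dots> = (\<Sum>b<N. X b i * (if b = a then of_real (D b) else 0))"
      using ia by (simp add: ev mult.commute if_distrib[of "(*) _"] cong: if_cong)
    also have "\<dots> = (U * E) $$ (i, a)"
      using ia by (auto simp: U_def E_def scalar_prod_def atLeast0LessThan intro!: sum.cong)
    finally show "(B * U) $$ (i, a) = (U * E) $$ (i, a)" .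
  qed (use B in \<open>auto simp: U_def E_def\<close>)
  have carr: "U \<in> carrier_mat N N" "V \<in> carrier_mat N N" "E \<in> carrier_mat N N"
    by (auto simp: U_def V_def E_def)
  have "B = U * E * V"
    unfolding BU[symmetric] using UV B(1) carr by (simp add: assoc_mult_mat[of _ N N _ N _ N])
  then have "similar_mat B E"
    using UV VU carr B by (intro similar_matI[of _ _ U V N]) auto
  then have "char_poly B = char_poly E" by (rule char_poly_similar)
  also have "\<dots> = (\<Prod>a\<leftarrow>diag_mat E. [:- a, 1:])"
    by (rule char_poly_upper_triangular[OF carr(3)]) (auto simp: E_def)
  also have "diag_mat E = map (\<lambda>a. complex_of_real (D a)) [0..<N]"
    by (auto simp: diag_mat_def E_def)
  finally show ?thesis .
qed

section \<open>Quaternionic structure and the singular values\<close>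

definition flip :: "nat \<Rightarrow> nat \<Rightarrow> nat" where
  "flip n i = (if i < n then i + n else i - n)"

definition jsgn :: "nat \<Rightarrow> nat \<Rightarrow> complex" where
  "jsgn n i = (if i < n then 1 else - 1)"

text \<open>The antilinear map on \<open>\<complex>\<^sup>2\<^sup>n\<close> that right multiplication by \<open>j\<close> induces
  when \<open>v\<^sub>1 + v\<^sub>2 j\<close> is stored as \<open>(v\<^sub>1, - cnj v\<^sub>2)\<close>.\<close>

definition jmap :: "nat \<Rightarrow> (nat \<Rightarrow> complex) \<Rightarrow> nat \<Rightarrow> complex" where
  "jmap n x = (\<lambda>i. jsgn n i * cnj (x (flip n i)))"

text \<open>Entrywise form of commuting with \<open>jmap n\<close>, equivalently of the block shape
  [[A1, A2], [-conj A2, conj A1]] of a complex adjoint matrix.\<close>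

definition quat_structured :: "nat \<Rightarrow> (nat \<Rightarrow> nat \<Rightarrow> complex) \<Rightarrow> bool" where
  "quat_structured n M \<longleftrightarrow> (\<forall>i<2 * n. \<forall>j<2 * n.
     M (flip n i) (flip n j) = jsgn n i * jsgn n j * cnj (M i j))"

lemma flip_less: "i < 2 * n \<Longrightarrow> flip n i < 2 * n"
  by (auto simp: flip_def)

lemma flip_flip: "i < 2 * n \<Longrightarrow> flip n (flip n i) = i"
  by (auto simp: flip_def)

lemma jsgn_flip: "i < 2 * n \<Longrightarrow> jsgn n (flip n i) = - jsgn n i"
  by (auto simp: flip_def jsgn_def)

lemma jsgn_mult_self: "jsgn n i * jsgn n i = 1"
  by (simp add: jsgn_def)

lemma sum_flip: "(\<Sum>i<2 * n. f (flip n i)) = (\<Sum>i<2 * n. f i)"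
  by (rule sum.reindex_bij_witness[of _ "flip n" "flip n"]) (auto simp: flip_less flip_flip)

lemma quat_structured_flip_right:
  assumes "quat_structured n M" "i < 2 * n" "j < 2 * n"
  shows "M i (flip n j) = - jsgn n i * jsgn n j * cnj (M (flip n i) j)"
proof -
  have "M (flip n (flip n i)) (flip n j) = jsgn n (flip n i) * jsgn n j * cnj (M (flip n i) j)"
    using assms flip_less unfolding quat_structured_def by blast
  then show ?thesis using assms by (simp add: flip_flip jsgn_flip)
qed

lemma app_jmap:
  assumes M: "quat_structured n M" and i: "i < 2 * n"
  shows "app (2 * n) M (jmap n x) i = jmap n (app (2 * n) M x) i"
proof -
  have "app (2 * n) M (jmap n x) i = (\<Sum>j<2 * n. M i (flip n j) * jmap n x (flip n j))"
    unfolding app_def by (rule sum_flip[symmetric])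
  also have "\<dots> = (\<Sum>j<2 * n. jsgn n i * cnj (M (flip n i) j * x j))"
  proof (intro sum.cong refl)
    fix j assume "j \<in> {..<2 * n}"
    then have j: "j < 2 * n" by simp
    show "M i (flip n j) * jmap n x (flip n j) = jsgn n i * cnj (M (flip n i) j * x j)"
      using jsgn_mult_self[of n j] j
      by (simp add: quat_structured_flip_right[OF M i j] jmap_def flip_flip jsgn_flip)
  qed
  finally show ?thesis by (simp add: jmap_def app_def sum_distrib_left)
qed

lemma cip_jmap_jmap: "cip (2 * n) (jmap n x) (jmap n y) = cnj (cip (2 * n) x y)"
proof -
  have "cip (2 * n) (jmap n x) (jmap n y) = (\<Sum>i<2 * n. cnj (x (flip n i)) * y (flip n i))"
    unfolding cip_def by (intro sum.cong refl) (auto simp: jmap_def jsgn_def)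
  also have "\<dots> = (\<Sum>i<2 * n. cnj (x i) * y i)" by (rule sum_flip)
  finally show ?thesis by (simp add: cip_def)
qed

text \<open>The sign comes from J^2 = -1, seen here through \<open>jsgn_flip\<close>. It makes J x
  orthogonal to x, so that a nonzero x and J x are independent.\<close>

lemma cip_jmap_left: "cip (2 * n) (jmap n x) y = - cip (2 * n) (jmap n y) x"
proof -
  have "cip (2 * n) (jmap n x) y = (\<Sum>i<2 * n. jmap n x (flip n i) * cnj (y (flip n i)))"
    unfolding cip_def by (rule sum_flip[symmetric])
  also have "\<dots> = (\<Sum>i<2 * n. - (jmap n y i * cnj (x i)))"
    by (intro sum.cong refl) (auto simp: jmap_def flip_flip jsgn_flip)
  finally show ?thesis by (simp add: cip_def sum_negf)
qed

lemma cip_jmap_self: "cip (2 * n) (jmap n x) x = 0"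
  using cip_jmap_left[of n x x] by simp

lemma quat_structured_gram:
  assumes M: "quat_structured n M"
  shows "quat_structured n (gram (2 * n) M)"
  unfolding quat_structured_def
proof (intro allI impI)
  fix i j assume ij: "i < 2 * n" "j < 2 * n"
  have "gram (2 * n) M (flip n i) (flip n j)
      = (\<Sum>k<2 * n. cnj (M (flip n k) (flip n i)) * M (flip n k) (flip n j))"
    unfolding gram_def by (rule sum_flip[symmetric])
  also have "\<dots> = (\<Sum>k<2 * n. jsgn n i * jsgn n j * cnj (cnj (M k i) * M k j))"
  proof (intro sum.cong refl)
    fix k assume "k \<in> {..<2 * n}"
    then have "M (flip n k) (flip n i) = jsgn n k * jsgn n i * cnj (M k i)"
        "M (flip n k) (flip n j) = jsgn n k * jsgn n j * cnj (M k j)"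
      using M ij by (auto simp: quat_structured_def)
    then show "cnj (M (flip n k) (flip n i)) * M (flip n k) (flip n j)
        = jsgn n i * jsgn n j * cnj (cnj (M k i) * M k j)"
      by (simp add: jsgn_def)
  qed
  finally show "gram (2 * n) M (flip n i) (flip n j)
      = jsgn n i * jsgn n j * cnj (gram (2 * n) M i j)"
    by (simp add: gram_def sum_distrib_left)
qed

text \<open>J is antilinear and would turn the eigenvalue into its conjugate; for a real eigenvalue
  it therefore preserves the eigenspace.\<close>

lemma jmap_eigenvector:
  assumes M: "quat_structured n M"
    and "\<forall>i<2 * n. app (2 * n) M x i = of_real r * x i" "i < 2 * n"
  shows "app (2 * n) M (jmap n x) i = of_real r * jmap n x i"
proof -
  have "app (2 * n) M (jmap n x) i = jmap n (app (2 * n) M x) i"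
    using M assms(3) by (rule app_jmap)
  also have "\<dots> = of_real r * jmap n x i"
    using assms flip_less[of i n] by (simp add: jmap_def)
  finally show ?thesis .
qed

section \<open>Spectral theorem for quaternionic frames\<close>

lemma gram_eigenvalue_real:
  assumes "\<exists>i<N. z i \<noteq> 0" "\<forall>i<N. app N (gram N M) z i = r * z i"
  shows "r = of_real (Re r)"
proof -
  \<comment> \<open>The eigenvalue is the Rayleigh quotient |M z|^2 / |z|^2, a quotient of
    reals.\<close>
  have "cip N (app N M z) (app N M z) = r * cip N z z"
    unfolding cip_gram[symmetric] cip_scale_left[symmetric] using assms(2) by (intro cip_cong) auto
  moreover have "cip N z z \<noteq> 0" using assms(1) by (auto simp: cip_self_eq_0_iff)
  ultimately have "r = cip N (app N M z) (app N M z) / cip N z z" by (simp add: field_simps)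
  then have "r \<in> \<real>" unfolding cip_self by (metis Reals_divide Reals_of_real)
  then show ?thesis by (simp add: of_real_Re)
qed

text \<open>Orthonormality over the quaternions: together with their images under
  \<open>jmap n\<close>, the \<open>m\<close> vectors form a complex orthonormal family of size
  \<open>2 * m\<close>.\<close>

definition quat_frame :: "nat \<Rightarrow> nat \<Rightarrow> (nat \<Rightarrow> nat \<Rightarrow> complex) \<Rightarrow> bool" where
  "quat_frame n m X \<longleftrightarrow> (\<forall>a<m. \<forall>b<m. cip (2 * n) (X a) (X b) = (if a = b then 1 else 0)
     \<and> cip (2 * n) (jmap n (X a)) (X b) = 0)"

text \<open>The orthogonal complement \<open>W\<close> of all \<open>X a\<close> and their images
  under J is invariant, because M^* M is self-adjoint and these are eigenvectors. It is nonzero as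
  \<open>2 * m < 2 * n\<close>, so it contains an eigenvector, which is then normalised.\<close>

lemma extend_quat_eigenframe:
  assumes M: "quat_structured n M" and X: "quat_frame n m X" and "m < n"
    and ev: "\<forall>a<m. \<forall>i<2 * n. app (2 * n) (gram (2 * n) M) (X a) i = of_real (d a) * X a i"
  obtains z r where "quat_frame n (Suc m) (X(m := z))"
    "\<forall>i<2 * n. app (2 * n) (gram (2 * n) M) z i = of_real (r::real) * z i"
proof -
  let ?N = "2 * n" and ?H = "gram (2 * n) M"
  define W where "W = (\<lambda>x. \<forall>a<m. cip ?N x (X a) = 0 \<and> cip ?N x (jmap n (X a)) = 0)"
  have cip_H: "cip ?N (app ?N ?H x) u = of_real r * cip ?N x u"
    if "\<And>i. i < ?N \<Longrightarrow> app ?N ?H u i = of_real r * u i" for x u and r :: real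
  proof -
    have "cip ?N (app ?N ?H x) u = cip ?N x (\<lambda>i. of_real r * u i)"
      unfolding cip_gram_right[symmetric] using that by (intro cip_cong) auto
    then show ?thesis by (simp add: cip_scale_right)
  qed
  have inv: "W (\<lambda>i. app ?N ?H x i - r * x i)" if "W x" for x r
    unfolding W_def
  proof (intro allI impI)
    fix a assume a: "a < m"
    have "cip ?N (app ?N ?H x) (X a) = of_real (d a) * cip ?N x (X a)"
      using ev a by (intro cip_H) auto
    moreover have "cip ?N (app ?N ?H x) (jmap n (X a)) = of_real (d a) * cip ?N x (jmap n (X a))"
      using ev a by (intro cip_H jmap_eigenvector[OF quat_structured_gram[OF M]]) auto
    ultimately show "cip ?N (\<lambda>i. app ?N ?H x i - r * x i) (X a) = 0
        \<and> cip ?N (\<lambda>i. app ?N ?H x i - r * x i) (jmap n (X a)) = 0"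
      using that a by (simp add: W_def cip_diff_left cip_scale_left)
  qed
  obtain y where y: "\<exists>k<?N. y k \<noteq> 0"
    "\<And>i. i < 2 * m \<Longrightarrow> (\<Sum>k<?N. cnj (if i < m then X i k else jmap n (X (i - m)) k) * y k) = 0"
    using \<open>m < n\<close>
    by (rule_tac homogeneous_solution[of "2 * m" ?N
          "\<lambda>i k. cnj (if i < m then X i k else jmap n (X (i - m)) k)"]) auto
  have "W y"
    unfolding W_def
  proof (intro allI impI)
    fix a assume "a < m"
    then show "cip ?N y (X a) = 0 \<and> cip ?N y (jmap n (X a)) = 0"
      using y(2)[of a] y(2)[of "a + m"] by (simp add: cip_def mult.commute)
  qed
  obtain z r where z: "W z" "\<exists>i<?N. z i \<noteq> 0" "\<forall>i<?N. app ?N ?H z i = r * z i"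
    using eigenvector_in_invariant_subspace[of W ?N ?H, OF inv \<open>W y\<close> y(1)] by blast
  have r: "r = of_real (Re r)" by (rule gram_eigenvalue_real[OF z(2,3)])
  define s where "s = (\<Sum>i<?N. (cmod (z i))\<^sup>2)"
  have zz: "cip ?N z z = of_real s" by (simp only: cip_self s_def)
  have "s \<ge> 0" by (simp add: s_def sum_nonneg)
  moreover have "s \<noteq> 0" using zz z(2) cip_self_eq_0_iff[of ?N z] by auto
  ultimately have s: "s > 0" by simp
  define c where "c = complex_of_real (1 / sqrt s)"
  define u where "u = (\<lambda>i. c * z i)"
  have "1 / sqrt s * (1 / sqrt s * s) = 1" using s by (simp add: field_simps)
  then have cc: "c * (c * of_real s) = 1"
    unfolding c_def of_real_mult[symmetric] by (simp only: of_real_1)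
  have cnjc: "cnj c = c" by (simp add: c_def)
  have uu: "cip ?N u u = 1"
    using cc by (simp add: u_def cip_scale_left cip_scale_right zz cnjc)
  have uX: "cip ?N u (X a) = 0" "cip ?N u (jmap n (X a)) = 0" if "a < m" for a
    using z(1) that by (auto simp: u_def cip_scale_left W_def)
  have Xu: "cip ?N (X a) u = 0" "cip ?N (jmap n (X a)) u = 0" if "a < m" for a
    using uX[OF that] by (simp_all add: cip_commute[of ?N _ u])
  \<comment> \<open>J u is orthogonal to the old vectors because u is orthogonal to their images
    under J.\<close>
  have juX: "cip ?N (jmap n u) (X a) = 0" if "a < m" for a
    using Xu(2)[OF that] cip_jmap_left[of n u "X a"] by simp
  show ?thesis
  proof (rule that)
    show "quat_frame n (Suc m) (X(m := u))"
      using X uu uX Xu juX by (auto simp: quat_frame_def less_Suc_eq cip_jmap_self)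
    have "app ?N ?H u i = c * app ?N ?H z i" for i
      by (simp add: u_def app_def sum_distrib_left mult_ac)
    then show "\<forall>i<?N. app ?N ?H u i = of_real (Re r) * u i"
      using z(3) r by (simp add: u_def)
  qed
qed

lemma quat_spectral:
  assumes M: "quat_structured n M" and "m \<le> n"
  shows "\<exists>X d. quat_frame n m X \<and>
    (\<forall>a<m. \<forall>i<2 * n. app (2 * n) (gram (2 * n) M) (X a) i = of_real (d a :: real) * X a i)"
  using \<open>m \<le> n\<close>
proof (induction m)
  case 0
  show ?case by (simp add: quat_frame_def)
next
  case (Suc m)
  then obtain X and d :: "nat \<Rightarrow> real" where X: "quat_frame n m X"
    "\<forall>a<m. \<forall>i<2 * n. app (2 * n) (gram (2 * n) M) (X a) i = of_real (d a) * X a i" by auto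
  obtain z r where z: "quat_frame n (Suc m) (X(m := z))"
    "\<forall>i<2 * n. app (2 * n) (gram (2 * n) M) z i = of_real (r::real) * z i"
    using extend_quat_eigenframe[OF M X(1) _ X(2)] Suc.prems by auto
  show ?case
  proof (intro exI conjI)
    show "quat_frame n (Suc m) (X(m := z))" by (rule z(1))
    show "\<forall>a<Suc m. \<forall>i<2 * n. app (2 * n) (gram (2 * n) M) ((X(m := z)) a) i
        = of_real ((d(m := r)) a) * (X(m := z)) a i"
      using z(2) X(2) by (auto simp: less_Suc_eq)
  qed
qed

lemma sorted_reindexing:
  fixes d :: "nat \<Rightarrow> real"
  obtains \<pi> where "bij_betw \<pi> {..<n} {..<n}" "\<And>a b. a \<le> b \<Longrightarrow> b < n \<Longrightarrow> d (\<pi> b) \<le> d (\<pi> a)"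
proof -
  define xs where "xs = rev (sort_key d [0..<n])"
  have len: "length xs = n" by (simp add: xs_def)
  have "bij_betw ((!) xs) {..<n} {..<n}"
    by (rule bij_betw_nth) (auto simp: xs_def)
  moreover have "d (xs ! b) \<le> d (xs ! a)" if "a \<le> b" "b < n" for a b
  proof -
    have "sorted (map d (sort_key d [0..<n]))" by simp
    then have "map d (sort_key d [0..<n]) ! (n - Suc b) \<le> map d (sort_key d [0..<n]) ! (n - Suc a)"
      using that by (intro sorted_nth_mono) auto
    then show ?thesis using that by (simp add: xs_def rev_nth)
  qed
  ultimately show ?thesis using that by blast
qed

lemma quat_spectral_sorted:
  assumes M: "quat_structured n M"
  obtains X and d :: "nat \<Rightarrow> real" where "orthoframe (2 * n) (2 * n) X"
    "\<And>a i. a < 2 * n \<Longrightarrow> i < 2 * n \<Longrightarrow>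
       app (2 * n) (gram (2 * n) M) (X a) i = of_real (d (a div 2)) * X a i"
    "\<And>a b. a \<le> b \<Longrightarrow> b < n \<Longrightarrow> d b \<le> d a"
proof -
  obtain X and d :: "nat \<Rightarrow> real" where X: "quat_frame n n X"
    and ev: "\<forall>a<n. \<forall>i<2 * n. app (2 * n) (gram (2 * n) M) (X a) i = of_real (d a) * X a i"
    using quat_spectral[OF M order_refl] by blast
  obtain \<pi> where bij: "bij_betw \<pi> {..<n} {..<n}"
    and anti: "\<And>a b. a \<le> b \<Longrightarrow> b < n \<Longrightarrow> d (\<pi> b) \<le> d (\<pi> a)"
    using sorted_reindexing[of n d] by blast
  have \<pi>: "\<pi> a < n" if "a < n" for a using bij that by (auto simp: bij_betw_def)
  have \<pi>_eq: "\<pi> a = \<pi> b \<longleftrightarrow> a = b" if "a < n" "b < n" for a b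
    using bij that by (auto simp: bij_betw_def inj_on_def)
  \<comment> \<open>Positions \<open>2 * j\<close> and \<open>2 * j + 1\<close> hold x and J x for
    the same eigenvalue, hence the index \<open>a div 2\<close>.\<close>
  define Y where "Y = (\<lambda>a. if even a then X (\<pi> (a div 2)) else jmap n (X (\<pi> (a div 2))))"
  have XX: "cip (2 * n) (X (\<pi> a)) (X (\<pi> b)) = (if a = b then 1 else 0)"
    "cip (2 * n) (jmap n (X (\<pi> a))) (X (\<pi> b)) = 0"
    "cip (2 * n) (X (\<pi> b)) (jmap n (X (\<pi> a))) = 0" if "a < n" "b < n" for a b
    using X \<pi>[OF that(1)] \<pi>[OF that(2)] \<pi>_eq[OF that]
    by (auto simp: quat_frame_def cip_commute[of _ _ "jmap n (X (\<pi> a))"])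
  show ?thesis
  proof (rule that)
    show "orthoframe (2 * n) (2 * n) Y"
      unfolding orthoframe_def
    proof (intro allI impI)
      fix a b assume "a < 2 * n" "b < 2 * n"
      then have ab: "a div 2 < n" "b div 2 < n" by auto
      have "a = b \<longleftrightarrow> a div 2 = b div 2 \<and> even a = even b"
        by (metis even_two_times_div_two odd_two_times_div_two_succ)
      then show "cip (2 * n) (Y a) (Y b) = (if a = b then 1 else 0)"
        using XX[OF ab] XX[OF ab(2,1)]
        by (cases "a div 2 = b div 2") (simp_all add: Y_def cip_jmap_jmap)
    qed
    show "app (2 * n) (gram (2 * n) M) (Y a) i = of_real ((d \<circ> \<pi>) (a div 2)) * Y a i"
      if "a < 2 * n" "i < 2 * n" for a i
    proof -
      have "\<pi> (a div 2) < n" using that \<pi> by simp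
      then show ?thesis
        using ev that jmap_eigenvector[OF quat_structured_gram[OF M]] by (simp add: Y_def)
    qed
  qed (use anti in simp)
qed

section \<open>Singular values and orthonormal frames\<close>

definition cadj_fun :: "nat \<Rightarrow> (nat \<Rightarrow> nat \<Rightarrow> quat) \<Rightarrow> nat \<Rightarrow> nat \<Rightarrow> complex" where
  "cadj_fun n A i j = cadj n A $$ (i, j)"

lemma quat_structured_cadj: "quat_structured n (cadj_fun n A)"
  by (auto simp: quat_structured_def cadj_fun_def cadj_def flip_def jsgn_def)

text \<open>The characteristic polynomial splits into the factors X - D a, so its roots are the
  \<open>D a\<close> with multiplicity; a decreasing \<open>D\<close> is already in the order that
  sorting and reversing produce.\<close>

lemma cadj_gram_eigs_eq:
  assumes X: "orthoframe (2 * n) (2 * n) X"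
    and ev: "\<And>a i. a < 2 * n \<Longrightarrow> i < 2 * n \<Longrightarrow>
       app (2 * n) (gram (2 * n) (cadj_fun n A)) (X a) i = of_real (D a) * X a i"
    and anti: "\<And>a b. a \<le> b \<Longrightarrow> b < 2 * n \<Longrightarrow> D b \<le> D a"
  shows "cadj_gram_eigs n A = map D [0..<2 * n]"
proof -
  let ?B = "cmat_adj (cadj n A) * cadj n A"
  have "char_poly ?B = (\<Prod>a\<leftarrow>map (\<lambda>a. complex_of_real (D a)) [0..<2 * n]. [:- a, 1:])"
  proof (rule char_poly_eigenbasis[OF X ev])
    show "?B \<in> carrier_mat (2 * n) (2 * n)"
      by (intro mult_carrier_mat[of _ _ "2 * n"]) (simp_all add: cmat_adj_def cadj_def)
    fix i j assume "i < 2 * n" "j < 2 * n"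
    then show "?B $$ (i, j) = gram (2 * n) (cadj_fun n A) i j"
      by (auto simp: gram_def cadj_fun_def cmat_adj_def scalar_prod_def atLeast0LessThan
          cadj_def[of n A, THEN arg_cong[where f = dim_row]]
          cadj_def[of n A, THEN arg_cong[where f = dim_col]] intro!: sum.cong)
  qed auto
  then have eq: "char_poly ?B = prod_list (map (\<lambda>a. [:- complex_of_real (D a), 1:]) [0..<2 * n])"
    by (simp add: o_def)
  have nz: "0 \<notin> set (map (\<lambda>a. [:- complex_of_real (D a), 1:]) [0..<2 * n])" by auto
  have "proots (char_poly ?B)
      = sum_list (map proots (map (\<lambda>a. [:- complex_of_real (D a), 1:]) [0..<2 * n]))"
    unfolding eq using proots_prod_list[OF nz] by simp
  also have "\<dots> = mset (map (\<lambda>a. complex_of_real (D a)) [0..<2 * n])"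
    by (induction n) (simp_all add: numeral_2_eq_2)
  finally have "image_mset Re (proots (char_poly ?B)) = mset (map D [0..<2 * n])"
    by (simp add: multiset.map_comp o_def)
  then have "cadj_gram_eigs n A = rev (sort (map D [0..<2 * n]))"
    by (simp add: cadj_gram_eigs_def del: mset_map)
  moreover have "sort (map D [0..<2 * n]) = rev (map D [0..<2 * n])"
  proof (rule properties_for_sort)
    show "sorted (rev (map D [0..<2 * n]))"
      by (auto simp: sorted_iff_nth_mono rev_nth intro!: anti)
  qed simp
  ultimately show ?thesis by simp
qed

lemma sum_pairs: "(\<Sum>a<2 * k. d (a div 2)) = 2 * (\<Sum>j<k. d j)" for d :: "nat \<Rightarrow> real"
  by (induction k) (simp_all add: algebra_simps)

text \<open>The interface to \<open>sval\<close>: all later facts about singular values go through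
  this eigenframe, whose eigenvalues are numbered from 0.\<close>

lemma sval_eigenframe:
  obtains X and d :: "nat \<Rightarrow> real" where "orthoframe (2 * n) (2 * n) X"
    "\<And>a i. a < 2 * n \<Longrightarrow> i < 2 * n \<Longrightarrow>
       app (2 * n) (gram (2 * n) (cadj_fun n A)) (X a) i = of_real (d (a div 2)) * X a i"
    "\<And>a b. a \<le> b \<Longrightarrow> b < n \<Longrightarrow> d b \<le> d a"
    "\<And>j. j < n \<Longrightarrow> (sval n A (Suc j))\<^sup>2 = d j" "\<And>j. j < n \<Longrightarrow> sval n A (Suc j) \<ge> 0"
proof -
  obtain X and d :: "nat \<Rightarrow> real" where X: "orthoframe (2 * n) (2 * n) X"
    and ev: "\<And>a i. a < 2 * n \<Longrightarrow> i < 2 * n \<Longrightarrow>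
       app (2 * n) (gram (2 * n) (cadj_fun n A)) (X a) i = of_real (d (a div 2)) * X a i"
    and anti: "\<And>a b. a \<le> b \<Longrightarrow> b < n \<Longrightarrow> d b \<le> d a"
    using quat_spectral_sorted[OF quat_structured_cadj] by blast
  have eigs: "cadj_gram_eigs n A = map (\<lambda>a. d (a div 2)) [0..<2 * n]"
    by (rule cadj_gram_eigs_eq[OF X ev]) (auto intro!: anti div_le_mono)
  \<comment> \<open>\<open>d j\<close> is |M x|^2 for a unit eigenvector x; this allows it to be
    recovered as the square of its square root.\<close>
  have nonneg: "d j \<ge> 0" if "j < n" for j
  proof -
    let ?x = "X (2 * j)"
    have "cip (2 * n) (app (2 * n) (gram (2 * n) (cadj_fun n A)) ?x) ?x
        = cip (2 * n) (\<lambda>i. of_real (d j) * ?x i) ?x"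
      using that by (intro cip_cong) (auto simp: ev)
    also have "\<dots> = of_real (d j)"
      using X that by (simp add: cip_scale_left orthoframe_def)
    finally have "d j = (\<Sum>i<2 * n. (cmod (app (2 * n) (cadj_fun n A) ?x i))\<^sup>2)"
      unfolding cip_gram cip_self of_real_eq_iff by simp
    then show ?thesis by (simp add: sum_nonneg)
  qed
  \<comment> \<open>\<open>sval\<close> counts from 1 and reads position 2 (k - 1), so
    \<open>Suc j\<close> picks position \<open>2 * j\<close>, where \<open>a div 2\<close> is
    \<open>j\<close>.\<close>
  have "sval n A (Suc j) = sqrt (d j)" if "j < n" for j
    using that by (simp add: sval_def eigs)
  with nonneg show ?thesis by (intro that[OF X ev anti]) auto
qed

text \<open>Ky Fan for complex frames of even size; the factor 2 is the doubling of each singular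
  value.\<close>

lemma sum_sval_upper:
  assumes Y: "orthoframe (2 * n) (2 * k) Y" and "k \<le> n"
  shows "(\<Sum>b<2 * k. \<Sum>i<2 * n. (cmod (app (2 * n) (cadj_fun n A) (Y b) i))\<^sup>2)
    \<le> 2 * (\<Sum>j<k. (sval n A (Suc j))\<^sup>2)"
proof -
  obtain X and d :: "nat \<Rightarrow> real" where X: "orthoframe (2 * n) (2 * n) X"
    and ev: "\<And>a i. a < 2 * n \<Longrightarrow> i < 2 * n \<Longrightarrow>
       app (2 * n) (gram (2 * n) (cadj_fun n A)) (X a) i = of_real (d (a div 2)) * X a i"
    and anti: "\<And>a b. a \<le> b \<Longrightarrow> b < n \<Longrightarrow> d b \<le> d a"
    and sv: "\<And>j. j < n \<Longrightarrow> (sval n A (Suc j))\<^sup>2 = d j"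
    by (rule sval_eigenframe[of n A]) blast
  have "(\<Sum>b<2 * k. \<Sum>i<2 * n. (cmod (app (2 * n) (cadj_fun n A) (Y b) i))\<^sup>2)
      = (\<Sum>b<2 * k. Re (cip (2 * n) (app (2 * n) (gram (2 * n) (cadj_fun n A)) (Y b)) (Y b)))"
    unfolding cip_gram cip_self by simp
  also have "\<dots> \<le> (\<Sum>a<2 * k. d (a div 2))"
    by (rule ky_fan[OF X ev _ Y]) (use \<open>k \<le> n\<close> in \<open>auto intro!: anti div_le_mono\<close>)
  also have "\<dots> = 2 * (\<Sum>j<k. (sval n A (Suc j))\<^sup>2)"
    using \<open>k \<le> n\<close> sv by (simp add: sum_pairs)
  finally show ?thesis .
qed

text \<open>The first \<open>2 * k\<close> eigenvectors belong to the \<open>k\<close> largest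
  eigenvalues, each counted twice, and so attain the bound.\<close>

lemma sum_sval_attained:
  assumes "k \<le> n"
  obtains Y where "orthoframe (2 * n) (2 * k) Y"
    "(\<Sum>b<2 * k. \<Sum>i<2 * n. (cmod (app (2 * n) (cadj_fun n A) (Y b) i))\<^sup>2)
      = 2 * (\<Sum>j<k. (sval n A (Suc j))\<^sup>2)"
proof -
  obtain X and d :: "nat \<Rightarrow> real" where X: "orthoframe (2 * n) (2 * n) X"
    and ev: "\<And>a i. a < 2 * n \<Longrightarrow> i < 2 * n \<Longrightarrow>
       app (2 * n) (gram (2 * n) (cadj_fun n A)) (X a) i = of_real (d (a div 2)) * X a i"
    and sv: "\<And>j. j < n \<Longrightarrow> (sval n A (Suc j))\<^sup>2 = d j"
    by (rule sval_eigenframe[of n A]) blast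
  have "(\<Sum>i<2 * n. (cmod (app (2 * n) (cadj_fun n A) (X b) i))\<^sup>2) = d (b div 2)"
    if "b < 2 * k" for b
  proof -
    have "b < 2 * n" using that assms by simp
    then have "cip (2 * n) (app (2 * n) (gram (2 * n) (cadj_fun n A)) (X b)) (X b)
        = cip (2 * n) (\<lambda>i. of_real (d (b div 2)) * X b i) (X b)"
      by (intro cip_cong) (auto simp: ev)
    also have "\<dots> = of_real (d (b div 2))"
      using X \<open>b < 2 * n\<close> by (simp add: cip_scale_left orthoframe_def)
    finally show ?thesis unfolding cip_gram cip_self of_real_eq_iff .
  qed
  then have "(\<Sum>b<2 * k. \<Sum>i<2 * n. (cmod (app (2 * n) (cadj_fun n A) (X b) i))\<^sup>2)
      = (\<Sum>b<2 * k. d (b div 2))"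
    by simp
  also have "\<dots> = 2 * (\<Sum>j<k. (sval n A (Suc j))\<^sup>2)"
    using assms sv by (simp add: sum_pairs)
  finally show ?thesis using X assms by (intro that[of X]) (auto simp: orthoframe_def)
qed

section \<open>Regular functions on a slice\<close>

definition param :: "quat \<Rightarrow> complex \<Rightarrow> quat" where
  "param I z = qreal (Re z) + Im z *\<^sub>R I"

section \<open>Quaternion arithmetic and imaginary units\<close>

lemma qmult_add_right: "qmult c (p + q) = qmult c p + qmult c q"
  by (simp add: qmult_def algebra_simps)

lemma qmult_scaleR_right: "qmult c (r *\<^sub>R p) = r *\<^sub>R qmult c p"
  by (simp add: qmult_def algebra_simps scaleR_conv_of_real)

lemma qmult_assoc: "qmult (qmult p q) r = qmult p (qmult q r)"
  by (simp add: qmult_def algebra_simps)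

lemma linear_qmult: "linear (qmult c)"
  by (intro linearI qmult_add_right qmult_scaleR_right)

lemma bounded_linear_qmult: "bounded_linear (qmult c)"
  using linear_qmult by (simp add: linear_conv_bounded_linear)

lemma norm_quat_power2: "(norm (q :: quat))\<^sup>2 = (cmod (fst q))\<^sup>2 + (cmod (snd q))\<^sup>2"
  by (simp add: norm_prod_def)

lemma norm_qmult_power2: "(norm (qmult p q))\<^sup>2 = (norm p)\<^sup>2 * (norm q)\<^sup>2"
  unfolding norm_quat_power2 qmult_def cmod_power2
  by (simp add: power2_eq_square algebra_simps)

lemma qmult_eq_0_iff: "qmult p q = 0 \<longleftrightarrow> p = 0 \<or> q = 0"
  using norm_qmult_power2[of p q] by (metis mult_eq_0_iff norm_eq_zero power2_eq_iff_nonneg zero_eq_power2)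

lemma qmult_left_cancel: "p \<noteq> 0 \<Longrightarrow> qmult p q = qmult p r \<longleftrightarrow> q = r"
  using linear_diff[OF linear_qmult, of p q r] qmult_eq_0_iff[of p "q - r"] by auto

text \<open>For q = a + b j the j-component of q^2 is 2 Re(a) b. Were Re(a) nonzero, b and Im(a)
  would vanish, leaving the impossible Re(a)^2 = -1.\<close>

lemma qsphere_iff: "q \<in> qsphere \<longleftrightarrow> Re (fst q) = 0 \<and> (Im (fst q))\<^sup>2 + (cmod (snd q))\<^sup>2 = 1"
proof
  assume "q \<in> qsphere"
  then have e: "fst q * fst q - snd q * cnj (snd q) = -1" "snd q * (fst q + cnj (fst q)) = 0"
    by (auto simp: qsphere_def qmult_def qreal_def algebra_simps)
  have re: "(Re (fst q))\<^sup>2 - (Im (fst q))\<^sup>2 - (cmod (snd q))\<^sup>2 = -1"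
    using arg_cong[OF e(1), of Re] by (simp add: power2_eq_square cmod_def)
  have im: "Re (fst q) * Im (fst q) = 0"
    using arg_cong[OF e(1), of Im] by auto
  have "Re (fst q) = 0"
  proof (rule ccontr)
    assume "Re (fst q) \<noteq> 0"
    then have "fst q + cnj (fst q) \<noteq> 0" by (simp add: complex_eq_iff)
    then have "snd q = 0" using e(2) by simp
    then have "(Re (fst q))\<^sup>2 = -1" using re im \<open>Re (fst q) \<noteq> 0\<close> by simp
    then show False by (metis neg_0_le_iff_le not_one_le_zero zero_le_power2)
  qed
  with re show "Re (fst q) = 0 \<and> (Im (fst q))\<^sup>2 + (cmod (snd q))\<^sup>2 = 1" by simp
next
  assume a: "Re (fst q) = 0 \<and> (Im (fst q))\<^sup>2 + (cmod (snd q))\<^sup>2 = 1"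
  then have "fst q * fst q - snd q * cnj (snd q) = -1"
    unfolding complex_norm_square[symmetric]
    by (auto simp: complex_eq_iff power2_eq_square)
  moreover have "fst q + cnj (fst q) = 0" using a by (simp add: complex_eq_iff)
  then have "snd q * (fst q + cnj (fst q)) = 0" by simp
  ultimately show "q \<in> qsphere"
    by (simp add: qsphere_def qmult_def qreal_def algebra_simps)
qed

text \<open>For \<open>I \<noteq> - \<i>\<close> one can take \<open>c = 1 - \<i> I\<close>; left multiplication by \<open>c\<close> turns
  left regular functions on the slice of \<open>I\<close> into pairs of holomorphic functions.\<close>

lemma qsphere_conjugate_to_i:
  assumes "I \<in> qsphere"
  obtains c where "c \<noteq> 0" "qmult c I = qmult (\<i>, 0) c"
proof (cases "I = (- \<i>, 0)")
  \<comment> \<open>Here 1 - i I = 0, so c = j is taken instead: j (-i) = i j.\<close>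
  case True
  then show ?thesis by (intro that[of "(0, 1)"]) (auto simp: qmult_def zero_prod_def)
next
  case False
  define t where "t = Im (fst I)"
  have re: "Re (fst I) = 0" and t: "t\<^sup>2 + (cmod (snd I))\<^sup>2 = 1"
    using assms by (auto simp: qsphere_iff t_def)
  have a: "fst I = \<i> * of_real t" using re by (simp add: complex_eq_iff t_def)
  have bb: "snd I * cnj (snd I) = of_real (1 - t\<^sup>2)"
    unfolding complex_norm_square[symmetric] using t by (intro arg_cong[where f = of_real]) simp
  define c where "c = (1 + complex_of_real t, - \<i> * snd I)"
  show ?thesis
  proof (rule that)
    show "c \<noteq> 0"
    proof
      assume "c = 0"
      then have "of_real t = (-1 :: complex)" "snd I = 0"
        by (auto simp: c_def zero_prod_def add_eq_0_iff)
      then have "I = (- \<i>, 0)" using a by (simp add: prod_eq_iff)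
      with False show False by simp
    qed
    \<comment> \<open>The components of (1 - i I) I = i + I = i (1 - i I), with I^2 = -1 entering
      through \<open>bb\<close>.\<close>
    have "fst (qmult c I) = (1 + of_real t) * (\<i> * of_real t) + \<i> * (snd I * cnj (snd I))"
      by (simp add: qmult_def c_def a)
    also have "\<dots> = \<i> * (1 + of_real t)"
      unfolding bb by (simp add: algebra_simps power2_eq_square)
    finally have "fst (qmult c I) = fst (qmult (\<i>, 0) c)" by (simp add: qmult_def c_def)
    moreover have "snd (qmult c I) = snd (qmult (\<i>, 0) c)"
      by (simp add: qmult_def c_def a algebra_simps)
    ultimately show "qmult c I = qmult (\<i>, 0) c" by (simp add: prod_eq_iff)
  qed
qed

section \<open>Complex coordinates on a slice\<close>

lemma param_of_real: "param I (of_real x) = qreal x"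
  by (simp add: param_def)

lemma range_param: "range (param I) = slice I"
proof
  show "slice I \<subseteq> range (param I)"
  proof
    fix q assume "q \<in> slice I"
    then obtain x y where "q = qreal x + y *\<^sub>R I" by (auto simp: slice_def)
    then have "q = param I (Complex x y)" by (simp add: param_def)
    then show "q \<in> range (param I)" by blast
  qed
qed (auto simp: param_def slice_def)

lemma continuous_param: "continuous_on UNIV (param I)"
  unfolding param_def qreal_def by (intro continuous_intros)

lemma open_vimage_param: "open \<Omega> \<Longrightarrow> open (param I -` \<Omega>)"
  using continuous_param by (simp add: continuous_on_open_vimage[OF open_UNIV])

text \<open>\<open>g\<close> is a continuous left inverse of \<open>param I\<close>, built from the
  real part and the inner product with I; it carries the connected set back to the plane.\<close>

lemma connected_vimage_param:
  assumes "I \<in> qsphere" "connected (\<Omega> \<inter> slice I)"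
  shows "connected (param I -` \<Omega>)"
proof -
  define g where "g = (\<lambda>q :: quat.
    Complex (Re (fst q)) (Im (fst q) * Im (fst I) + Re (cnj (snd I) * snd q)))"
  have g: "g (param I z) = z" for z
  proof -
    have "Im (fst I) * Im (fst I) + (Re (snd I) * Re (snd I) + Im (snd I) * Im (snd I)) = 1"
      using assms(1) unfolding qsphere_iff cmod_power2 by (simp add: power2_eq_square)
    then have "Im z * (Im (fst I) * Im (fst I) + (Re (snd I) * Re (snd I) + Im (snd I) * Im (snd I))) = Im z"
      by simp
    then show ?thesis
      unfolding distrib_left using assms(1)
      by (simp add: g_def param_def qreal_def qsphere_iff complex_eq_iff mult_ac)
  qed
  have "param I -` \<Omega> = g ` (\<Omega> \<inter> slice I)"
  proof (intro equalityI subsetI)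
    fix z assume "z \<in> param I -` \<Omega>"
    then have "param I z \<in> \<Omega> \<inter> slice I" unfolding range_param[symmetric] by blast
    then show "z \<in> g ` (\<Omega> \<inter> slice I)" by (rule image_eqI[rotated]) (rule g[symmetric])
  next
    fix z assume "z \<in> g ` (\<Omega> \<inter> slice I)"
    then obtain w where "z = g (param I w)" "param I w \<in> \<Omega>"
      unfolding range_param[symmetric] by blast
    then show "z \<in> param I -` \<Omega>" by (simp add: g)
  qed
  moreover have "continuous_on (\<Omega> \<inter> slice I) g"
    unfolding g_def Complex_eq by (intro continuous_intros)
  ultimately show ?thesis using connected_continuous_image assms(2) by metis
qed

text \<open>A nonreal \<open>q\<close> lies in the slice of its normalised imaginary part; a real
  one lies in every slice, so \<open>I\<close> serves.\<close>

lemma quat_in_slice: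
  assumes "I \<in> qsphere"
  obtains J z where "J \<in> qsphere" "q = param J z"
proof (cases "q = qreal (Re (fst q))")
  case True
  then show ?thesis using that[OF assms, of "of_real (Re (fst q))"] by (simp add: param_of_real)
next
  case False
  define v where "v = (\<i> * of_real (Im (fst q)), snd q)"
  have q: "q = qreal (Re (fst q)) + v"
    by (simp add: v_def qreal_def prod_eq_iff complex_eq_iff)
  with False have v: "norm v \<noteq> 0" by auto
  have nv: "(norm v)\<^sup>2 = (Im (fst q))\<^sup>2 + (cmod (snd q))\<^sup>2"
    unfolding norm_quat_power2 by (simp add: v_def norm_mult)
  define J where "J = (1 / norm v) *\<^sub>R v"
  have comps: "fst v = \<i> * of_real (Im (fst q))" "snd v = snd q" by (simp_all add: v_def)
  have "(Im (fst J))\<^sup>2 + (cmod (snd J))\<^sup>2 = ((Im (fst q))\<^sup>2 + (cmod (snd q))\<^sup>2) / (norm v)\<^sup>2"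
    by (simp add: J_def comps power_divide add_divide_distrib)
  also have "\<dots> = 1" using v by (simp flip: nv)
  finally have "J \<in> qsphere" by (simp add: qsphere_iff J_def comps)
  moreover have "q = param J (Complex (Re (fst q)) (norm v))"
    using v q by (simp add: param_def J_def)
  ultimately show ?thesis by (rule that)
qed

section \<open>Regular functions as pairs of holomorphic functions\<close>

lemma regular_has_derivative:
  assumes "open \<Omega>" "I \<in> qsphere" and f: "regular \<Omega> f" and z: "z \<in> param I -` \<Omega>"
  obtains Dx Dy where "Dx = - qmult I Dy"
    "((\<lambda>z. f (param I z)) has_derivative (\<lambda>w. Re w *\<^sub>R Dx + Im w *\<^sub>R Dy)) (at z)"
proof -
  define g where "g = (\<lambda>(x::real, y::real). f (qreal x + y *\<^sub>R I))"
  define S where "S = {(x::real, y::real). qreal x + y *\<^sub>R I \<in> \<Omega>}"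
  have "S = (\<lambda>p. qreal (fst p) + snd p *\<^sub>R I) -` \<Omega>" by (auto simp: S_def)
  moreover have "continuous_on UNIV (\<lambda>p::real \<times> real. qreal (fst p) + snd p *\<^sub>R I)"
    unfolding qreal_def by (intro continuous_intros)
  ultimately have "open S" using \<open>open \<Omega>\<close> by (simp add: continuous_on_open_vimage[OF open_UNIV])
  have zS: "(Re z, Im z) \<in> S" using z by (simp add: S_def param_def)
  have "g differentiable_on S" using f \<open>I \<in> qsphere\<close> by (auto simp: regular_def g_def S_def)
  then have "g differentiable (at (Re z, Im z))"
    using \<open>open S\<close> zS by (simp add: differentiable_on_eq_differentiable_at)
  then obtain L where L: "(g has_derivative L) (at (Re z, Im z))"
    by (auto simp: differentiable_def)
  obtain Dx Dy where
    Dx: "((\<lambda>t. f (qreal t + Im z *\<^sub>R I)) has_vector_derivative Dx) (at (Re z))" and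
    Dy: "((\<lambda>t. f (qreal (Re z) + t *\<^sub>R I)) has_vector_derivative Dy) (at (Im z))" and
    half: "(1/2::real) *\<^sub>R (Dx + qmult I Dy) = 0"
    using f \<open>I \<in> qsphere\<close> z unfolding regular_def param_def vimage_eq by blast
  have linL: "linear L" using L by (simp add: has_derivative_linear)
  \<comment> \<open>Along the coordinate axes the total derivative agrees with the partial
    derivatives that regularity provides; by linearity these determine it.\<close>
  have "((\<lambda>t. g (t, Im z)) has_derivative (\<lambda>t. L (t, 0))) (at (Re z))"
    by (rule has_derivative_compose[of "\<lambda>t. (t, Im z)", OF _ L])
      (auto intro!: derivative_eq_intros)
  moreover have "((\<lambda>t. g (t, Im z)) has_derivative (\<lambda>t. t *\<^sub>R Dx)) (at (Re z))"
    using Dx by (simp add: has_vector_derivative_def g_def)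
  ultimately have "(\<lambda>t. L (t, 0)) = (\<lambda>t. t *\<^sub>R Dx)" by (rule has_derivative_unique)
  then have Lx: "L (t, 0) = t *\<^sub>R Dx" for t by metis
  have "((\<lambda>t. g (Re z, t)) has_derivative (\<lambda>t. L (0, t))) (at (Im z))"
    by (rule has_derivative_compose[of "\<lambda>t. (Re z, t)", OF _ L])
      (auto intro!: derivative_eq_intros)
  moreover have "((\<lambda>t. g (Re z, t)) has_derivative (\<lambda>t. t *\<^sub>R Dy)) (at (Im z))"
    using Dy by (simp add: has_vector_derivative_def g_def)
  ultimately have "(\<lambda>t. L (0, t)) = (\<lambda>t. t *\<^sub>R Dy)" by (rule has_derivative_unique)
  then have Ly: "L (0, t) = t *\<^sub>R Dy" for t by metis
  have Lxy: "L (s, t) = s *\<^sub>R Dx + t *\<^sub>R Dy" for s t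
    using linear_add[OF linL, of "(s, 0)" "(0, t)"] by (simp add: Lx Ly)
  have "((\<lambda>w. g (Re w, Im w)) has_derivative (\<lambda>w. L (Re w, Im w))) (at z)"
    by (rule has_derivative_compose[of "\<lambda>w. (Re w, Im w)", OF _ L])
      (auto intro!: derivative_eq_intros)
  then have "((\<lambda>z. f (param I z)) has_derivative (\<lambda>w. Re w *\<^sub>R Dx + Im w *\<^sub>R Dy)) (at z)"
    by (simp add: g_def param_def Lxy)
  moreover have "Dx = - qmult I Dy" using half by (simp add: add_eq_0_iff2)
  ultimately show ?thesis by (intro that)
qed

text \<open>Multiplying Dx = - I Dy by \<open>c\<close> from the left gives c Dy = i c Dx. Left
  multiplication by i is scalar on both complex components, so this is the Cauchy-Riemann equation
  for each.\<close>

lemma regular_components_holomorphic: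
  assumes "open \<Omega>" "I \<in> qsphere" "regular \<Omega> f" and c: "qmult c I = qmult (\<i>, 0) c"
  shows "(\<lambda>z. fst (qmult c (f (param I z)))) holomorphic_on param I -` \<Omega>"
    and "(\<lambda>z. snd (qmult c (f (param I z)))) holomorphic_on param I -` \<Omega>"
proof -
  have *: "\<exists>a b. ((\<lambda>z. fst (qmult c (f (param I z)))) has_field_derivative a) (at z) \<and>
      ((\<lambda>z. snd (qmult c (f (param I z)))) has_field_derivative b) (at z)"
    if z: "z \<in> param I -` \<Omega>" for z
  proof -
    obtain Dx Dy where D: "Dx = - qmult I Dy"
      "((\<lambda>z. f (param I z)) has_derivative (\<lambda>w. Re w *\<^sub>R Dx + Im w *\<^sub>R Dy)) (at z)"
      using regular_has_derivative[OF assms(1-3) z] by metis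
    have "qmult c Dx = - qmult (\<i>, 0) (qmult c Dy)"
      unfolding D(1) linear_neg[OF linear_qmult] using c by (simp flip: qmult_assoc)
    then have Dy: "fst (qmult c Dy) = \<i> * fst (qmult c Dx)" "snd (qmult c Dy) = \<i> * snd (qmult c Dx)"
      by (simp_all add: qmult_def[of "(\<i>, 0)"])
    have w: "qmult c (Re w *\<^sub>R Dx + Im w *\<^sub>R Dy)
        = (fst (qmult c Dx) * w, snd (qmult c Dx) * w)" for w
      unfolding qmult_add_right qmult_scaleR_right
      by (subst (3) complex_eq[of w], subst (5) complex_eq[of w])
        (simp add: prod_eq_iff Dy scaleR_conv_of_real algebra_simps)
    have "((\<lambda>z. qmult c (f (param I z))) has_derivative
        (\<lambda>w. (fst (qmult c Dx) * w, snd (qmult c Dx) * w))) (at z)"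
      using bounded_linear.has_derivative[OF bounded_linear_qmult D(2), of c] unfolding w .
    from has_derivative_fst[OF this] has_derivative_snd[OF this] show ?thesis
      by (auto simp: has_field_derivative_def)
  qed
  show "(\<lambda>z. fst (qmult c (f (param I z)))) holomorphic_on param I -` \<Omega>"
    and "(\<lambda>z. snd (qmult c (f (param I z)))) holomorphic_on param I -` \<Omega>"
    unfolding holomorphic_on_open[OF open_vimage_param[OF assms(1)]]
    by (intro ballI; drule *; elim exE conjE; rule exI; assumption)+
qed

text \<open>If \<open>\<Sum>\<bar>h\<bar>\<^sup>2\<close> is maximal at \<open>z0\<close>, so is the real part of the holomorphic function
  \<open>\<langle>h(z), h(z0)\<rangle>\<close>, to whose exponential the maximum modulus principle applies.\<close>

lemma sum_norm_strong_maximum: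
  fixes h :: "'k \<Rightarrow> complex \<Rightarrow> complex \<times> complex"
  assumes D: "open D" "connected D" "z0 \<in> D"
    and hol: "\<And>k. k \<in> K \<Longrightarrow> (\<lambda>z. fst (h k z)) holomorphic_on D"
      "\<And>k. k \<in> K \<Longrightarrow> (\<lambda>z. snd (h k z)) holomorphic_on D"
    and max: "\<And>z. z \<in> D \<Longrightarrow> (\<Sum>k\<in>K. (norm (h k z))\<^sup>2) \<le> (\<Sum>k\<in>K. (norm (h k z0))\<^sup>2)"
    and "finite K" "k \<in> K" "z \<in> D"
  shows "h k z = h k z0"
proof -
  define \<phi> where "\<phi> = (\<lambda>z. \<Sum>k\<in>K. cnj (fst (h k z0)) * fst (h k z) + cnj (snd (h k z0)) * snd (h k z))"
  have re: "Re (\<phi> z) = (\<Sum>k\<in>K. inner (h k z) (h k z0))" for z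
    by (simp add: \<phi>_def inner_prod_def inner_complex_def algebra_simps)
  \<comment> \<open>Expanding the square serves twice: it bounds Re \<phi> by its value at
    \<open>z0\<close>, and in the case of equality it forces h(z) = h(z0).\<close>
  have dist: "(\<Sum>k\<in>K. (norm (h k z - h k z0))\<^sup>2)
      = (\<Sum>k\<in>K. (norm (h k z))\<^sup>2) - 2 * Re (\<phi> z) + (\<Sum>k\<in>K. (norm (h k z0))\<^sup>2)" for z
    unfolding re power2_norm_eq_inner
    by (simp add: inner_diff_left inner_diff_right inner_commute sum.distrib sum_subtractf
        sum_distrib_left algebra_simps flip: sum_distrib_left)
  have re0: "Re (\<phi> z0) = (\<Sum>k\<in>K. (norm (h k z0))\<^sup>2)"
    by (simp add: re power2_norm_eq_inner)
  have le: "Re (\<phi> z) \<le> Re (\<phi> z0)" if "z \<in> D" for z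
  proof -
    have "0 \<le> (\<Sum>k\<in>K. (norm (h k z - h k z0))\<^sup>2)" by (simp add: sum_nonneg)
    then show ?thesis using dist[of z] max[OF that] re0 by simp
  qed
  have "(\<lambda>z. exp (\<phi> z)) constant_on D"
  proof (rule maximum_modulus_principle[OF _ D(1,2,1) order_refl D(3)])
    show "(\<lambda>z. exp (\<phi> z)) holomorphic_on D"
      unfolding \<phi>_def by (intro holomorphic_intros hol)
  qed (simp add: le norm_exp_eq_Re)
  then have "exp (\<phi> z) = exp (\<phi> z0)" using D(3) \<open>z \<in> D\<close> unfolding constant_on_def by metis
  then have "Re (\<phi> z) = Re (\<phi> z0)" by (metis exp_inj_iff norm_exp_eq_Re)
  then have "(\<Sum>k\<in>K. (norm (h k z - h k z0))\<^sup>2) \<le> 0"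
    using dist[of z] max[OF \<open>z \<in> D\<close>] re0 by simp
  then have "(\<Sum>k\<in>K. (norm (h k z - h k z0))\<^sup>2) = 0"
    by (intro antisym sum_nonneg) auto
  then show ?thesis using \<open>finite K\<close> \<open>k \<in> K\<close> by (simp add: sum_nonneg_eq_0_iff)
qed

text \<open>The identity theorem on the slice of \<open>J\<close>: after multiplication by
  \<open>c\<close> both components are holomorphic, and the real points of the domain, where they
  are constant, accumulate at \<open>x0\<close>.\<close>

lemma regular_eq_const_on_slice:
  assumes "open \<Omega>" "connected (\<Omega> \<inter> slice J)" and J: "J \<in> qsphere" and f: "regular \<Omega> f"
    and x0: "qreal x0 \<in> \<Omega>" and real: "\<And>x. qreal x \<in> \<Omega> \<Longrightarrow> f (qreal x) = C"
    and z: "param J z \<in> \<Omega>"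
  shows "f (param J z) = C"
proof -
  let ?D = "param J -` \<Omega>"
  obtain c where c: "c \<noteq> 0" "qmult c J = qmult (\<i>, 0) c" by (rule qsphere_conjugate_to_i[OF J])
  note hol = regular_components_holomorphic[OF \<open>open \<Omega>\<close> J f c(2)]
  have D: "open ?D" "connected ?D"
    using open_vimage_param connected_vimage_param assms(1,2) J by auto
  have x0D: "of_real x0 \<in> ?D" using x0 by (simp add: param_of_real)
  have lim: "of_real x0 islimpt (?D \<inter> \<real>)"
  proof -
    obtain d where d: "d > 0" "ball (of_real x0) d \<subseteq> ?D" using D(1) x0D by (meson open_contains_ball)
    show ?thesis unfolding islimpt_approachable
    proof (intro allI impI)
      fix e :: real assume "e > 0"
      \<comment> \<open>Half of \<open>min e d\<close> keeps the real point within both radii and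
        distinct from \<open>x0\<close>.\<close>
      define y where "y = complex_of_real (x0 + min e d / 2)"
      have "y - of_real x0 = of_real (min e d / 2)" by (simp add: y_def)
      then have dy: "dist y (of_real x0) = min e d / 2"
        using \<open>e > 0\<close> d(1) by (simp add: dist_norm del: of_real_divide)
      then have "dist y (of_real x0) < d" using d(1) min.cobounded2[of e d] by linarith
      then have "y \<in> ?D" by (intro subsetD[OF d(2)]) (simp add: dist_commute)
      moreover have "y \<in> \<real>" unfolding y_def by (rule Reals_of_real)
      moreover have "y \<noteq> of_real x0" using dy \<open>e > 0\<close> d(1) by (auto simp: min_def split: if_splits)
      moreover have "dist y (of_real x0) < e"
        using dy \<open>e > 0\<close> min.cobounded1[of e d] by linarith
      ultimately show "\<exists>x'\<in>?D \<inter> \<real>. x' \<noteq> of_real x0 \<and> dist x' (of_real x0) < e" by blast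
    qed
  qed
  have on_real: "f (param J y) = C" if "y \<in> ?D \<inter> \<real>" for y
    using that real by (auto simp: param_of_real elim!: Reals_cases)
  have "fst (qmult c (f (param J z))) - fst (qmult c C) = 0"
    by (rule analytic_continuation[OF _ D _ x0D lim, of "\<lambda>z. fst (qmult c (f (param J z))) - fst (qmult c C)"])
      (use z on_real hol in \<open>auto intro!: holomorphic_intros\<close>)
  moreover have "snd (qmult c (f (param J z))) - snd (qmult c C) = 0"
    by (rule analytic_continuation[OF _ D _ x0D lim, of "\<lambda>z. snd (qmult c (f (param J z))) - snd (qmult c C)"])
      (use z on_real hol in \<open>auto intro!: holomorphic_intros\<close>)
  ultimately have "qmult c (f (param J z)) = qmult c C" by (simp add: prod_eq_iff)
  then show ?thesis unfolding qmult_left_cancel[OF c(1)] .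
qed

section \<open>The maximum principle for singular values\<close>

text \<open>Undoes the storage of v1 + v2 j as (v1, - cnj v2).\<close>

definition quat_comp :: "nat \<Rightarrow> (nat \<Rightarrow> complex) \<Rightarrow> nat \<Rightarrow> quat" where
  "quat_comp n x i = (x i, - cnj (x (i + n)))"

lemma sum_double_split: "(\<Sum>i<2 * n. f i) = (\<Sum>i<n. f i + f (i + n))"
  for f :: "nat \<Rightarrow> 'a :: comm_monoid_add"
proof -
  have "(\<Sum>i<2 * n. f i) = sum f ({..<n} \<union> {n..<n + n})" by (rule sum.cong) auto
  also have "\<dots> = (\<Sum>i<n. f i) + (\<Sum>i=n..<n + n. f i)"
    by (rule sum.union_disjoint) auto
  also have "(\<Sum>i=n..<n + n. f i) = (\<Sum>i<n. f (i + n))"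
    using sum.shift_bounds_nat_ivl[of f 0 n n] by (simp add: atLeast0LessThan)
  finally show ?thesis by (simp add: sum.distrib)
qed

lemma sum_norm_quat_comp: "(\<Sum>i<n. (norm (quat_comp n x i))\<^sup>2) = (\<Sum>i<2 * n. (cmod (x i))\<^sup>2)"
  unfolding norm_quat_power2 sum_double_split by (simp add: quat_comp_def)

lemma cadj_fun_blocks:
  assumes "i < n" "j < n"
  shows "cadj_fun n A i j = fst (A i j)" "cadj_fun n A i (j + n) = snd (A i j)"
    "cadj_fun n A (i + n) j = - cnj (snd (A i j))" "cadj_fun n A (i + n) (j + n) = cnj (fst (A i j))"
  using assms by (simp_all add: cadj_fun_def cadj_def)

text \<open>With this storage the complex adjoint acts as A itself, with the vector on the right, so
  a left factor \<open>c\<close> meets the entries of A first.\<close>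

lemma quat_comp_app_cadj:
  assumes "i < n"
  shows "quat_comp n (app (2 * n) (cadj_fun n A) x) i = (\<Sum>j<n. qmult (A i j) (quat_comp n x j))"
proof -
  have "app (2 * n) (cadj_fun n A) x i = (\<Sum>j<n. fst (A i j) * x j + snd (A i j) * x (j + n))"
    unfolding app_def sum_double_split using assms
    by (intro sum.cong refl) (simp add: cadj_fun_blocks)
  moreover have "app (2 * n) (cadj_fun n A) x (i + n)
      = (\<Sum>j<n. - cnj (snd (A i j)) * x j + cnj (fst (A i j)) * x (j + n))"
    unfolding app_def sum_double_split using assms
    by (intro sum.cong refl) (simp add: cadj_fun_blocks)
  ultimately show ?thesis
    by (simp add: quat_comp_def qmult_def prod_eq_iff fst_sum snd_sum flip: sum_negf)
qed

lemma quat_comp_inject: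
  assumes "\<And>i. i < n \<Longrightarrow> quat_comp n x i = quat_comp n y i" "i < 2 * n"
  shows "x i = y i"
  using assms(1)[of i] assms(1)[of "i - n"] assms(2) by (cases "i < n") (auto simp: quat_comp_def)

text \<open>Entries of c F(q) v are sums of c F(q)_ij times constants on the right, which keep both
  components holomorphic. Their square norms add up to |c|^2 times the given sum, so
  \<open>sum_norm_strong_maximum\<close> applies and \<open>c\<close> cancels.\<close>

lemma frame_strong_maximum:
  fixes m :: nat
  assumes "open \<Omega>" "connected (\<Omega> \<inter> slice I)" and I: "I \<in> qsphere"
    and F: "\<forall>i<n. \<forall>j<n. regular \<Omega> (\<lambda>q. F q i j)"
    and q0: "q0 \<in> \<Omega> \<inter> slice I"
    and max: "\<And>q. q \<in> \<Omega> \<inter> slice I \<Longrightarrow>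
      (\<Sum>b<m. \<Sum>i<2 * n. (cmod (app (2 * n) (cadj_fun n (F q)) (Y b) i))\<^sup>2)
      \<le> (\<Sum>b<m. \<Sum>i<2 * n. (cmod (app (2 * n) (cadj_fun n (F q0)) (Y b) i))\<^sup>2)"
    and q: "q \<in> \<Omega> \<inter> slice I" and b: "b < m" and i: "i < 2 * n"
  shows "app (2 * n) (cadj_fun n (F q)) (Y b) i = app (2 * n) (cadj_fun n (F q0)) (Y b) i"
proof (rule quat_comp_inject[OF _ i])
  fix i' assume i': "i' < n"
  let ?D = "param I -` \<Omega>"
  obtain c where c: "c \<noteq> 0" "qmult c I = qmult (\<i>, 0) c" by (rule qsphere_conjugate_to_i[OF I])
  define g where "g = (\<lambda>q (b, i). quat_comp n (app (2 * n) (cadj_fun n (F q)) (Y b)) i)"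
  define h where "h = (\<lambda>k z. qmult c (g (param I z) k))"
  obtain z0 z where z: "q0 = param I z0" "q = param I z"
    using q0 q unfolding range_param[symmetric] by blast
  have zD: "z0 \<in> ?D" "z \<in> ?D" using q0 q z by auto
  have D: "open ?D" "connected ?D"
    using open_vimage_param connected_vimage_param assms(1,2) I by auto
  let ?K = "{..<m} \<times> {..<n}"
  have sum_h: "(\<Sum>k\<in>?K. (norm (h k z))\<^sup>2)
      = (norm c)\<^sup>2 * (\<Sum>b<m. \<Sum>i<2 * n. (cmod (app (2 * n) (cadj_fun n (F (param I z))) (Y b) i))\<^sup>2)" for z
    unfolding h_def norm_qmult_power2 sum_distrib_left[symmetric] sum_norm_quat_comp[symmetric]
    by (simp add: g_def sum.cartesian_product split_def)
  have hol: "(\<lambda>z. fst (h k z)) holomorphic_on ?D" "(\<lambda>z. snd (h k z)) holomorphic_on ?D"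
    if "k \<in> ?K" for k
  proof -
    obtain b i where k: "k = (b, i)" "i < n" using \<open>k \<in> ?K\<close> by auto
    have h: "h k z = (\<Sum>j<n. qmult (qmult c (F (param I z) i j)) (quat_comp n (Y b) j))" for z
      using k(2) by (simp add: h_def g_def k(1) quat_comp_app_cadj linear_sum[OF linear_qmult] qmult_assoc)
    have F': "(\<lambda>z. fst (qmult c (F (param I z) i j))) holomorphic_on ?D"
      "(\<lambda>z. snd (qmult c (F (param I z) i j))) holomorphic_on ?D" if "j < n" for j
      using F k(2) that regular_components_holomorphic[OF \<open>open \<Omega>\<close> I _ c(2), of "\<lambda>q. F q i j"] by auto
    show "(\<lambda>z. fst (h k z)) holomorphic_on ?D" "(\<lambda>z. snd (h k z)) holomorphic_on ?D"
      unfolding h fst_sum snd_sum qmult_def[of "qmult _ _"] fst_conv snd_conv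
      by (intro holomorphic_intros F'; simp)+
  qed
  have "h (b, i') z = h (b, i') z0"
  proof (rule sum_norm_strong_maximum[OF D zD(1) hol, where K = ?K])
    show "(\<Sum>k\<in>?K. (norm (h k w))\<^sup>2) \<le> (\<Sum>k\<in>?K. (norm (h k z0))\<^sup>2)" if "w \<in> ?D" for w
      unfolding sum_h using max[of "param I w"] that z(1) range_param[of I]
      by (intro mult_left_mono) auto
  qed (use b i' zD in auto)
  then show "quat_comp n (app (2 * n) (cadj_fun n (F q)) (Y b)) i'
      = quat_comp n (app (2 * n) (cadj_fun n (F q0)) (Y b)) i'"
    unfolding h_def qmult_left_cancel[OF c(1)] by (simp add: g_def z)
qed

text \<open>For a frame \<open>Y\<close> optimal at \<open>q0\<close>, Ky Fan gives E(q) <= 2 S(q)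
  <= 2 S(q0) = E(q0), so E is maximal at \<open>q0\<close> and \<open>frame_strong_maximum\<close>
  freezes the images of \<open>Y\<close>.\<close>

lemma sval_sum_strong_maximum:
  fixes F :: "quat \<Rightarrow> nat \<Rightarrow> nat \<Rightarrow> quat" and n :: nat
  defines "S \<equiv> \<lambda>k q. \<Sum>j<k. (sval n (F q) (Suc j))\<^sup>2"
  assumes "open \<Omega>" "connected (\<Omega> \<inter> slice I)" "I \<in> qsphere"
    and "\<forall>i<n. \<forall>j<n. regular \<Omega> (\<lambda>q. F q i j)"
    and q0: "q0 \<in> \<Omega> \<inter> slice I" and "k \<le> n"
    and max: "\<And>q. q \<in> \<Omega> \<inter> slice I \<Longrightarrow> S k q \<le> S k q0"
  obtains Y where "orthoframe (2 * n) (2 * k) Y"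
    "\<And>q b i. q \<in> \<Omega> \<inter> slice I \<Longrightarrow> b < 2 * k \<Longrightarrow> i < 2 * n \<Longrightarrow>
      app (2 * n) (cadj_fun n (F q)) (Y b) i = app (2 * n) (cadj_fun n (F q0)) (Y b) i"
    "\<And>q. q \<in> \<Omega> \<inter> slice I \<Longrightarrow> S k q = S k q0"
proof -
  define E where "E = (\<lambda>Y q. \<Sum>b<2 * k. \<Sum>i<2 * n. (cmod (app (2 * n) (cadj_fun n (F q)) (Y b) i))\<^sup>2)"
  obtain Y where Y: "orthoframe (2 * n) (2 * k) Y" and "E Y q0 = 2 * S k q0"
    using sum_sval_attained[OF \<open>k \<le> n\<close>, of "F q0"] unfolding E_def S_def by blast
  moreover have upper: "E Y q \<le> 2 * S k q" for q
    unfolding E_def S_def by (rule sum_sval_upper[OF Y \<open>k \<le> n\<close>])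
  ultimately have "E Y q \<le> E Y q0" if "q \<in> \<Omega> \<inter> slice I" for q
    using max[OF that] upper[of q] by linarith
  then have const: "app (2 * n) (cadj_fun n (F q)) (Y b) i = app (2 * n) (cadj_fun n (F q0)) (Y b) i"
    if "q \<in> \<Omega> \<inter> slice I" "b < 2 * k" "i < 2 * n" for q b i
    using frame_strong_maximum[OF assms(2-5) q0, where m = "2 * k" and Y = Y] that unfolding E_def by blast
  \<comment> \<open>Conversely 2 S(q0) = E(q0) = E(q) <= 2 S(q).\<close>
  have "S k q = S k q0" if "q \<in> \<Omega> \<inter> slice I" for q
  proof -
    have "E Y q = E Y q0" unfolding E_def using const[OF that] by simp
    then show ?thesis using max[OF that] upper[of q] \<open>E Y q0 = 2 * S k q0\<close> by linarith
  qed
  with Y const show ?thesis by (rule that)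
qed

text \<open>Different singular values may attain their maxima at different points. Once the sum of
  the first k squares is constant, however, a maximum point of the next singular value is one of the
  next sum.\<close>

lemma constant_on_slice:
  fixes F :: "quat \<Rightarrow> nat \<Rightarrow> nat \<Rightarrow> quat"
  assumes F: "open \<Omega>" "connected (\<Omega> \<inter> slice I)" "I \<in> qsphere"
      "\<forall>i<n. \<forall>j<n. regular \<Omega> (\<lambda>q. F q i j)"
    and max: "\<forall>k\<in>{1..n}. \<exists>q0\<in>\<Omega> \<inter> slice I. \<forall>q\<in>\<Omega> \<inter> slice I. sval n (F q) k \<le> sval n (F q0) k"
    and p: "p \<in> \<Omega> \<inter> slice I" and q: "q \<in> \<Omega> \<inter> slice I" and ij: "i < n" "j < n"
  shows "F q i j = F p i j"
proof -
  have const: "(\<Sum>j<k. (sval n (F q) (Suc j))\<^sup>2) = (\<Sum>j<k. (sval n (F p) (Suc j))\<^sup>2)"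
    if "k \<le> n" "q \<in> \<Omega> \<inter> slice I" "p \<in> \<Omega> \<inter> slice I" for k p q
    using that
  proof (induction k arbitrary: p q)
    case (Suc k)
    obtain q0 where q0: "q0 \<in> \<Omega> \<inter> slice I"
      and q0max: "\<And>q. q \<in> \<Omega> \<inter> slice I \<Longrightarrow> sval n (F q) (Suc k) \<le> sval n (F q0) (Suc k)"
      using max Suc.prems(1) by fastforce
    have le: "(\<Sum>j<Suc k. (sval n (F q) (Suc j))\<^sup>2) \<le> (\<Sum>j<Suc k. (sval n (F q0) (Suc j))\<^sup>2)"
      if q: "q \<in> \<Omega> \<inter> slice I" for q
    proof -
      \<comment> \<open>Nonnegativity lets the maximum pass from the singular value to its
        square.\<close>
      have "0 \<le> sval n (F q) (Suc k)"
        using sval_eigenframe[of n "F q"] Suc.prems(1) Suc_le_lessD by metis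
      then have "(sval n (F q) (Suc k))\<^sup>2 \<le> (sval n (F q0) (Suc k))\<^sup>2"
        using q0max[OF q] by (intro power_mono)
      then show ?thesis using Suc.IH[OF _ q q0] Suc.prems(1) by simp
    qed
    show ?case
      using sval_sum_strong_maximum[OF F q0 Suc.prems(1) le] Suc.prems(2,3) by metis
  qed simp
  \<comment> \<open>As the full sum is constant, \<open>p\<close> itself is a maximum point, so a
    frame optimal at \<open>p\<close> can be used; with \<open>2 * n\<close> vectors it is a
    basis.\<close>
  obtain Y where Y: "orthoframe (2 * n) (2 * n) Y"
    and MY: "\<And>b i. b < 2 * n \<Longrightarrow> i < 2 * n \<Longrightarrow>
      app (2 * n) (cadj_fun n (F q)) (Y b) i = app (2 * n) (cadj_fun n (F p)) (Y b) i"
    using sval_sum_strong_maximum[OF F p order_refl] const[OF order_refl _ p] q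
    by (metis order_refl)
  have entry: "cadj_fun n (F q) i l = cadj_fun n (F p) i l" if "l < 2 * n" for l
  proof -
    \<comment> \<open>Expanding the l-th unit vector in the basis \<open>Y\<close> recovers column
      \<open>l\<close> of the matrix.\<close>
    define e where "e = (\<lambda>a. if a = l then 1 else 0 :: complex)"
    have e: "app (2 * n) A e i = A i l" for A
      using that by (simp add: app_def e_def if_distrib[of "(*) _"] cong: if_cong)
    show ?thesis
      unfolding e[symmetric] app_orthoframe_expansion[OF Y, of _ e i] using MY ij(1) by simp
  qed
  show ?thesis
    \<comment> \<open>In the upper rows, columns \<open>j\<close> and \<open>j + n\<close> hold the
      two complex components of entry (i, j).\<close>
    using entry[of j] entry[of "j + n"] ij by (simp add: cadj_fun_blocks prod_eq_iff)
qed

theorem theorem3p12: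
  fixes \<Omega> :: "quat set" and I :: quat and n :: nat
    and F :: "quat \<Rightarrow> nat \<Rightarrow> nat \<Rightarrow> quat"
  assumes "slice_domain \<Omega>"
    and "I \<in> qsphere"
    and "\<forall>i<n. \<forall>j<n. regular \<Omega> (\<lambda>q. F q i j)"
    and "\<forall>k\<in>{1..n}. \<exists>q0\<in>\<Omega> \<inter> slice I. \<forall>q\<in>\<Omega> \<inter> slice I. sval n (F q) k \<le> sval n (F q0) k"
  shows "\<exists>C. \<forall>q\<in>\<Omega>. \<forall>i<n. \<forall>j<n. F q i j = C i j"
proof -
  have \<Omega>: "open \<Omega>" "\<And>J. J \<in> qsphere \<Longrightarrow> connected (\<Omega> \<inter> slice J)"
    using assms(1) by (auto simp: slice_domain_def)
  obtain x0 where x0: "qreal x0 \<in> \<Omega>" using assms(1) by (auto simp: slice_domain_def)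
  have real_slice: "qreal x \<in> slice I" for x
    by (metis param_of_real range_param rangeI)
  \<comment> \<open>Real points belong to the slice of \<open>I\<close>, where F is constant, and to
    every other slice, so the identity theorem spreads the value from them.\<close>
  have "F q i j = F (qreal x0) i j" if q: "q \<in> \<Omega>" and ij: "i < n" "j < n" for q i j
  proof -
    obtain J z where J: "J \<in> qsphere" "q = param J z" by (rule quat_in_slice[OF assms(2)])
    have "F (param J z) i j = F (qreal x0) i j"
    proof (rule regular_eq_const_on_slice[OF \<Omega>(1) \<Omega>(2)[OF J(1)] J(1) _ x0])
      show "regular \<Omega> (\<lambda>q. F q i j)" using assms(3) ij by blast
      show "F (qreal x) i j = F (qreal x0) i j" if "qreal x \<in> \<Omega>" for x
        using constant_on_slice[OF \<Omega>(1) \<Omega>(2) assms(2-4) _ _ ij] assms(2) that x0 real_slice by blast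
      show "param J z \<in> \<Omega>" using q J(2) by simp
    qed
    then show ?thesis unfolding J(2) .
  qed
  then show ?thesis by blast
qed

end
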